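(* Assume that (i) $v_1$ (resp. $v_2$) is a non-negative viscosity sub-solution (resp. super-solution) to the HJB equation $\max\{\max_{u\in[0,1]}\mathcal L^uf(x),\mathcal Mf(x)\}=0$; (ii) both $v_1$ and $v_2$ belong to $\mathcal A$; (iii) either $\sup_{x\ge0}(v_1(x)-v_2(x))>v_1(a)-v_2(a)$, or $v_1-v_2$ is differentiable at $a$. Then $v_1\le v_2$.
   Context: Fix constants $a>0$, $\mu_+,\mu_-\in\mathbb R$, $\sigma_+,\sigma_->0$, $q>0$, $\beta>0$. For continuous $\phi:[0,\infty)\to\mathbb R$, $\mathcal M\phi(x)=\sup_{0\le\eta\le x}(\phi(x-\eta)+\eta-\beta)-\phi(x)$. For $f\in C^2$ and $u\in[0,1]$, $$\mathcal L^uf(x)=\tfrac12(\sigma_+^2\mathbf 1_{\{x>a\}}+\sigma_-^2\mathbf 1_{\{x\le a\}})u^2f''(x)+(\mu_+\mathbf 1_{\{x>a\}}+\mu_-\mathbf 1_{\{x\le a\}})uf'(x)-qf(x).$$ $\mathcal A$ is the set of $f\in C([0,\infty))$ that are nonnegative, of polynomial growth, locally Lipschitz continuous on $(0,\infty)$, with $f(0)=0$. Let $w$ be a continuous function on $[0,\infty)$, locally Lipschitz on $(0,\infty)$. It is a viscosity super-solution if for every $x\in(0,a)\cup(a,\infty)$ and every $\phi\in C^2((0,\infty))$ with $w(x)=\phi(x)$ and $w\ge\phi$ on $(0,\infty)$: $\max\{\max_{u\in[0,1]}\mathcal L^u\phi(x),\mathcal Mw(x)\}\le0$. It is a viscosity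 sub-solution if for every $x\in(0,\infty)$ and every $\varphi\in C^2((0,\infty))$ with $w(x)=\varphi(x)$ and $w\le\varphi$ on $(0,\infty)$: $\max\{\max_{u\in[0,1]}\mathcal L^u\varphi(x),\mathcal Mw(x)\}\ge0$. *)

theory Defs
  imports "HOL-Analysis.Analysis"
begin

text \<open>
  Functions on \<open>[0, \<infinity>)\<close> or \<open>(0, \<infinity>)\<close> are total functions on the reals; every notion
  below depends only on their values on the relevant half-line.
\<close>

text \<open>Meant for open \<open>S\<close>: the derivatives are two-sided.\<close>

definition C2_on :: "real set \<Rightarrow> (real \<Rightarrow> real) \<Rightarrow> bool" where
  "C2_on S f \<longleftrightarrow> (\<exists>f' f''.
     (\<forall>x\<in>S. (f has_real_derivative f' x) (at x)) \<and>
     (\<forall>x\<in>S. (f' has_real_derivative f'' x) (at x)) \<and>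
     continuous_on S f'')"

definition locally_lipschitz_on :: "real set \<Rightarrow> (real \<Rightarrow> real) \<Rightarrow> bool" where
  "locally_lipschitz_on S f \<longleftrightarrow>
     (\<forall>x\<in>S. \<exists>e>0. \<exists>C. C-lipschitz_on (ball x e \<inter> S) f)"

definition polynomial_growth :: "(real \<Rightarrow> real) \<Rightarrow> bool" where
  "polynomial_growth f \<longleftrightarrow> (\<exists>C. \<exists>n::nat. \<forall>x\<ge>0. \<bar>f x\<bar> \<le> C * (1 + x ^ n))"

definition class_A :: "(real \<Rightarrow> real) set" where
  "class_A = {f. continuous_on {0..} f \<and> (\<forall>x\<ge>0. 0 \<le> f x) \<and> polynomial_growth f \<and>
                 locally_lipschitz_on {0<..} f \<and> f 0 = 0}"

definition M_op :: "real \<Rightarrow> (real \<Rightarrow> real) \<Rightarrow> real \<Rightarrow> real" where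
  "M_op \<beta> \<phi> x = (SUP \<eta>\<in>{0..x}. \<phi> (x - \<eta>) + \<eta> - \<beta>) - \<phi> x"

text \<open>The point \<open>x = a\<close> itself belongs to the lower regime.\<close>

definition L_op ::
  "real \<Rightarrow> real \<Rightarrow> real \<Rightarrow> real \<Rightarrow> real \<Rightarrow> real \<Rightarrow> real \<Rightarrow> (real \<Rightarrow> real) \<Rightarrow> real \<Rightarrow> real" where
  "L_op a \<mu>p \<mu>m \<sigma>p \<sigma>m q u f x =
     1/2 * (\<sigma>p\<^sup>2 * indicator {a<..} x + \<sigma>m\<^sup>2 * indicator {..a} x) * u\<^sup>2 * deriv (deriv f) x
     + (\<mu>p * indicator {a<..} x + \<mu>m * indicator {..a} x) * u * deriv f x
     - q * f x"

text \<open>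
  The left-hand side of the HJB equation, with the differential part evaluated at the test
  function \<open>\<phi>\<close> and the nonlocal part at \<open>w\<close>.  The maximum over \<open>u\<close> is written as a
  supremum; it is attained, the expression being a polynomial in \<open>u\<close>.
\<close>

definition HJB_lhs ::
  "real \<Rightarrow> real \<Rightarrow> real \<Rightarrow> real \<Rightarrow> real \<Rightarrow> real \<Rightarrow> real \<Rightarrow>
   (real \<Rightarrow> real) \<Rightarrow> (real \<Rightarrow> real) \<Rightarrow> real \<Rightarrow> real" where
  "HJB_lhs a \<mu>p \<mu>m \<sigma>p \<sigma>m q \<beta> \<phi> w x =
     max (SUP u\<in>{0..1}. L_op a \<mu>p \<mu>m \<sigma>p \<sigma>m q u \<phi> x) (M_op \<beta> w x)"

definition viscosity_supersolution ::
  "real \<Rightarrow> real \<Rightarrow> real \<Rightarrow> real \<Rightarrow> real \<Rightarrow> real \<Rightarrow> real \<Rightarrow> (real \<Rightarrow> real) \<Rightarrow> bool" where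
  "viscosity_supersolution a \<mu>p \<mu>m \<sigma>p \<sigma>m q \<beta> w \<longleftrightarrow>
     continuous_on {0..} w \<and> locally_lipschitz_on {0<..} w \<and>
     (\<forall>x\<in>{0<..<a} \<union> {a<..}. \<forall>\<phi>. C2_on {0<..} \<phi> \<and> w x = \<phi> x \<and> (\<forall>y>0. \<phi> y \<le> w y) \<longrightarrow>
        HJB_lhs a \<mu>p \<mu>m \<sigma>p \<sigma>m q \<beta> \<phi> w x \<le> 0)"

definition viscosity_subsolution ::
  "real \<Rightarrow> real \<Rightarrow> real \<Rightarrow> real \<Rightarrow> real \<Rightarrow> real \<Rightarrow> real \<Rightarrow> (real \<Rightarrow> real) \<Rightarrow> bool" where
  "viscosity_subsolution a \<mu>p \<mu>m \<sigma>p \<sigma>m q \<beta> w \<longleftrightarrow>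
     continuous_on {0..} w \<and> locally_lipschitz_on {0<..} w \<and>
     (\<forall>x>0. \<forall>\<phi>. C2_on {0<..} \<phi> \<and> w x = \<phi> x \<and> (\<forall>y>0. w y \<le> \<phi> y) \<longrightarrow>
        0 \<le> HJB_lhs a \<mu>p \<mu>m \<sigma>p \<sigma>m q \<beta> \<phi> w x)"

end

theory Submission
  imports Defs
begin

text \<open>
  Suppose \<open>v1 > v2\<close> somewhere. Since \<open>v1\<close> grows polynomially, \<open>W = v1 - v2 - \<epsilon> exp (k x)\<close> attains a
  positive maximum at some \<open>x0 > 0\<close>; for small \<open>k\<close> the exponential is a strict supersolution of
  the linear part. Being strictly increasing, it also excludes jumps of \<open>v1\<close> near \<open>x0\<close>, so that
  only the differential part of the equation matters there. If \<open>x0 \<noteq> a\<close>, the theorem on sums in one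
  regime gives a contradiction. If \<open>x0 = a\<close>, then the first alternative of the hypothesis fails for small
  \<open>\<epsilon>\<close>, so \<open>W' a = 0\<close>, and Hopf's lemma on the interval to the left of \<open>a\<close> gives a contradiction.

  The theorem on sums needs no Alexandrov theorem in one dimension: a lower bound \<open>P\<close> on the
  second-order parts of all superjets of \<open>f\<close> means that \<open>f x - P / 2 * x\<^sup>2\<close> is convex.
\<close>

section \<open>Superjets and convexity\<close>

text \<open>The viscosity superjet without a little-o remainder: the parabola itself must dominate
  near \<open>x\<close>. Subjets of \<open>w\<close> appear as superjets of
  \<open>- w\<close>.\<close>

definition superjet :: "(real \<Rightarrow> real) \<Rightarrow> real \<Rightarrow> real \<Rightarrow> real \<Rightarrow> bool" where
  "superjet f x d p \<longleftrightarrow> (\<forall>\<^sub>F y in nhds x. f y \<le> f x + d * (y - x) + p / 2 * (y - x)\<^sup>2)"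

lemma superjet_add:
  assumes "superjet f x d p" "superjet g x d' p'"
  shows "superjet (\<lambda>y. f y + g y) x (d + d') (p + p')"
  using assms unfolding superjet_def
  by eventually_elim (simp add: algebra_simps add_divide_distrib)

lemma superjet_cong:
  assumes "superjet f x d p" "\<And>y. g y = f y"
  shows "superjet g x d p"
  using assms by (simp add: superjet_def)

lemma superjet_cmult:
  assumes "superjet f x d p" "0 \<le> c"
  shows "superjet (\<lambda>y. c * f y) x (c * d) (c * p)"
  using assms(1) unfolding superjet_def
proof eventually_elim
  case (elim y)
  from mult_left_mono[OF this assms(2)] show ?case by (simp add: algebra_simps)
qed

lemma superjet_parabola: "superjet (\<lambda>y. c * y\<^sup>2) x (2 * c * x) (2 * c)"
  by (simp add: superjet_def power2_eq_square algebra_simps)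

text \<open>A chord lying strictly below the graph, bent slightly by a parabola, would touch \<open>f\<close> from
  above with second derivative less than \<open>P\<close>.\<close>
lemma convex_on_if_superjets_ge:
  assumes cont: "continuous_on {l<..<r} f"
    and jets: "\<And>x d p. x \<in> {l<..<r} \<Longrightarrow> superjet f x d p \<Longrightarrow> P \<le> p"
  shows "convex_on {l<..<r} (\<lambda>x. f x - P / 2 * x\<^sup>2)"
proof (rule convex_on_linorderI)
  fix t x y :: real
  assume t: "0 < t" "t < 1" and x: "x \<in> {l<..<r}" and y: "y \<in> {l<..<r}" and "x < y"
  define h where "h = (\<lambda>x. f x - P / 2 * x\<^sup>2)"
  define z where "z = (1 - t) * x + t * y"
  have zx: "z - x = t * (y - x)" and yz: "y - z = (1 - t) * (y - x)"
    by (auto simp: z_def algebra_simps)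
  have z: "x < z" "z < y" using zx yz t \<open>x < y\<close>
    by (metis diff_gt_0_iff_gt mult_pos_pos)+
  show "f ((1 - t) *\<^sub>R x + t *\<^sub>R y) - P / 2 * ((1 - t) *\<^sub>R x + t *\<^sub>R y)\<^sup>2
     \<le> (1 - t) * (f x - P / 2 * x\<^sup>2) + t * (f y - P / 2 * y\<^sup>2)"
  proof (rule ccontr)
    assume "\<not> ?thesis"
    then have above: "h z > (1 - t) * h x + t * h y" by (simp add: h_def z_def)
    \<comment> \<open>\<open>b\<close> is the slope of the chord; \<open>e\<close> is half the bend
      that would lift the chord to the graph at \<open>z\<close>. So \<open>k\<close> vanishes at
      both ends, is still positive at \<open>z\<close>, and has an interior maximum.\<close>
    define b where "b = (h y - h x) / (y - x)"
    define e where "e = (h z - h x - b * (z - x)) / (2 * ((z - x) * (y - z)))"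
    define k where "k = (\<lambda>s. h s - h x - b * (s - x) - e * ((s - x) * (y - s)))"
    have "b * (z - x) = t * (h y - h x)" using \<open>x < y\<close> zx by (simp add: b_def)
    then have num: "h z - h x - b * (z - x) > 0" using above by (simp add: algebra_simps)
    moreover have den: "(z - x) * (y - z) > 0" using z by simp
    ultimately have e: "e > 0" by (simp add: e_def)
    have "e * ((z - x) * (y - z)) = (h z - h x - b * (z - x)) / 2"
      using den z by (simp add: e_def)
    then have kz: "k z > 0" using num by (simp add: k_def)
    have kx: "k x = 0" by (simp add: k_def)
    have "b * (y - x) = h y - h x" using \<open>x < y\<close> by (simp add: b_def)
    then have ky: "k y = 0" by (simp add: k_def)
    have sub: "{x..y} \<subseteq> {l<..<r}" using x y by auto
    have "continuous_on {x..y} k" unfolding k_def h_def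
      by (intro continuous_intros continuous_on_subset[OF cont sub])
    then obtain s where s: "s \<in> {x..y}" "\<And>s'. s' \<in> {x..y} \<Longrightarrow> k s' \<le> k s"
      using continuous_attains_sup[of "{x..y}" k] \<open>x < y\<close> by auto
    have "k s > 0" using s(2)[of z] z kz by simp
    then have s': "s \<in> {x<..<y}" using s(1) kx ky by (auto simp: less_le)
    have "superjet f s (P * s + b + e * (x + y - 2 * s)) (P - 2 * e)"
      unfolding superjet_def
    proof (rule eventually_mono)
      show "\<forall>\<^sub>F s' in nhds s. s' \<in> {x<..<y}"
        using s' by (intro eventually_nhds_in_open) auto
      fix s' assume "s' \<in> {x<..<y}"
      then have "k s' \<le> k s" using s(2) by auto
      then show "f s' \<le> f s + (P * s + b + e * (x + y - 2 * s)) * (s' - s) + (P - 2 * e) / 2 * (s' - s)\<^sup>2"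
        unfolding k_def h_def by (simp add: power2_eq_square field_simps)
    qed
    from jets[OF _ this] have "P \<le> P - 2 * e" using s(1) sub by blast
    then show False using e by simp
  qed
qed simp

text \<open>Moving against the sign of \<open>d\<close>, the parabola falls at rate
  \<open>\<bar>d\<bar>\<close> up to a quadratic error, so a steeper slope than \<open>L\<close>
  would cut below the cone. Taking \<open>L = 0\<close> identifies slopes, taking a Lipschitz
  constant bounds them.\<close>

lemma superjet_slope_le:
  assumes "superjet f x d p" and "\<forall>\<^sub>F y in nhds x. f x - L * \<bar>y - x\<bar> \<le> f y"
  shows "\<bar>d\<bar> \<le> L"
proof -
  have "\<forall>\<^sub>F y in nhds x. 0 \<le> L * \<bar>y - x\<bar> + d * (y - x) + p / 2 * (y - x)\<^sup>2"
    using assms unfolding superjet_def by eventually_elim simp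
  then obtain \<epsilon> where \<epsilon>: "\<epsilon> > 0"
    "\<And>y. dist y x < \<epsilon> \<Longrightarrow> 0 \<le> L * \<bar>y - x\<bar> + d * (y - x) + p / 2 * (y - x)\<^sup>2"
    by (auto simp: eventually_nhds_metric)
  show ?thesis
  proof (rule ccontr)
    assume "\<not> ?thesis"
    then have D: "0 < \<bar>d\<bar> - L" by simp
    define t where "t = min (\<epsilon> / 2) ((\<bar>d\<bar> - L) / (\<bar>p\<bar> + 1))"
    define \<theta> where "\<theta> = (if d < 0 then 1 else - 1 :: real)"
    have \<theta>: "\<bar>\<theta>\<bar> = 1" "d * \<theta> = - \<bar>d\<bar>" "\<theta> * \<theta> = 1" by (auto simp: \<theta>_def)
    have "t > 0" using \<epsilon>(1) D by (simp add: t_def)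
    moreover have "t \<le> \<epsilon> / 2" unfolding t_def by (rule min.cobounded1)
    ultimately have t: "t > 0" "t < \<epsilon>" using \<epsilon>(1) by linarith+
    have "t \<le> (\<bar>d\<bar> - L) / (\<bar>p\<bar> + 1)" by (simp add: t_def)
    then have "t * (\<bar>p\<bar> + 1) \<le> \<bar>d\<bar> - L" by (simp add: pos_le_divide_eq)
    then have "\<bar>p\<bar> * t < \<bar>d\<bar> - L" using t(1) by (simp add: algebra_simps)
    moreover have "p / 2 * t \<le> \<bar>p\<bar> * t" using t(1) by (intro mult_right_mono) auto
    ultimately have "t * (L - \<bar>d\<bar> + p / 2 * t) < 0" using t(1) by (intro mult_pos_neg) linarith+
    moreover have "0 \<le> L * \<bar>x + \<theta> * t - x\<bar> + d * (x + \<theta> * t - x) + p / 2 * (x + \<theta> * t - x)\<^sup>2"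
      by (rule \<epsilon>(2)) (use t \<theta> in \<open>simp add: dist_real_def abs_mult\<close>)
    moreover have "L * \<bar>x + \<theta> * t - x\<bar> + d * (x + \<theta> * t - x) + p / 2 * (x + \<theta> * t - x)\<^sup>2
        = L * t + (d * \<theta>) * t + p / 2 * (\<theta> * \<theta>) * (t * t)"
      using t \<theta>(1) by (simp add: abs_mult power2_eq_square)
    then have "L * \<bar>x + \<theta> * t - x\<bar> + d * (x + \<theta> * t - x) + p / 2 * (x + \<theta> * t - x)\<^sup>2
        = t * (L - \<bar>d\<bar> + p / 2 * t)"
      unfolding \<theta> by (simp add: algebra_simps)
    ultimately show False by linarith
  qed
qed

section \<open>Supporting lines and superjets of convex functions\<close>

lemma convex_on_supporting_line:
  fixes k :: "real \<Rightarrow> real"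
  assumes "convex_on {l<..<r} k" "x \<in> {l<..<r}"
  obtains e where "\<And>y. y \<in> {l<..<r} \<Longrightarrow> k x + e * (y - x) \<le> k y"
  using convex_le_Inf_differential[OF assms(1), of x] assms(2) by (auto simp: interior_open)

text \<open>The supporting line from below and the superjet from above touch at \<open>x\<close> and
  so share their slope; local information thereby becomes a bound on the whole interval.\<close>

lemma convex_on_superjet_tangent:
  assumes "convex_on {l<..<r} k" "x \<in> {l<..<r}" "superjet k x d p" "y \<in> {l<..<r}"
  shows "k x + d * (y - x) \<le> k y"
proof -
  obtain e where e: "\<And>y. y \<in> {l<..<r} \<Longrightarrow> k x + e * (y - x) \<le> k y"
    using convex_on_supporting_line assms by blast
  have "superjet (\<lambda>y. k y - (k x + e * (y - x))) x (d - e) p"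
    using assms(3) unfolding superjet_def by eventually_elim (simp add: algebra_simps)
  moreover have "\<forall>\<^sub>F y in nhds x. k x + e * (y - x) \<le> k y"
    by (rule eventually_mono[OF eventually_nhds_in_open[of "{l<..<r}"]]) (use assms e in auto)
  ultimately have "\<bar>d - e\<bar> \<le> 0" by (intro superjet_slope_le) auto
  then have "d = e" by simp
  then show ?thesis using e assms by blast
qed

text \<open>The tangent at \<open>x\<close>, followed for a distance \<open>\<tau>\<close> to either
  side, must stay under the parabola centred at \<open>x0\<close>. Its endpoint is within
  \<open>2 * \<tau>\<close> of \<open>x0\<close>, so the excess is at most
  \<open>4 * c * \<tau>\<^sup>2\<close>, and division by \<open>\<tau>\<close> bounds the
  slope.\<close>

lemma superjet_slope_near:
  assumes k: "convex_on {l<..<r} k"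
    and up: "\<And>y. y \<in> {l<..<r} \<Longrightarrow> k y \<le> k x0 + e0 * (y - x0) + c * (y - x0)\<^sup>2"
    and low: "\<And>y. y \<in> {l<..<r} \<Longrightarrow> k x0 + e0 * (y - x0) \<le> k y"
    and "0 \<le> c" "0 < \<tau>" "{x0 - 2 * \<tau>..x0 + 2 * \<tau>} \<subseteq> {l<..<r}"
    and "\<bar>x - x0\<bar> < \<tau>" "superjet k x e p"
  shows "\<bar>e - e0\<bar> \<le> 4 * c * \<tau>"
proof -
  have *: "e * (y - x) \<le> (e0 + sgn (y - x) * (4 * c * \<tau>)) * (y - x)" if "\<bar>y - x\<bar> = \<tau>" for y
  proof -
    have in1: "x \<in> {x0 - 2 * \<tau>..x0 + 2 * \<tau>}" "y \<in> {x0 - 2 * \<tau>..x0 + 2 * \<tau>}"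
      using that assms(7) by (simp_all add: abs_less_iff abs_le_iff abs_if split: if_splits)
    then have in2: "x \<in> {l<..<r}" "y \<in> {l<..<r}" using assms by blast+
    have "(y - x0)\<^sup>2 \<le> (2 * \<tau>)\<^sup>2" using in1 by (intro abs_le_square_iff[THEN iffD1]) auto
    then have "c * (y - x0)\<^sup>2 \<le> c * (2 * \<tau>)\<^sup>2" using \<open>0 \<le> c\<close> by (rule mult_left_mono)
    moreover have "k x + e * (y - x) \<le> k y"
      using convex_on_superjet_tangent[OF k] in2 assms by blast
    moreover have "k x0 + e0 * (x - x0) \<le> k x" using low in2 by blast
    moreover have "k y \<le> k x0 + e0 * (y - x0) + c * (y - x0)\<^sup>2" using up in2 by blast
    moreover have "sgn (y - x) * (y - x) = \<tau>" using that by (simp add: abs_sgn mult.commute)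
    then have "sgn (y - x) * (4 * c * \<tau>) * (y - x) = 4 * c * \<tau> * \<tau>" by (metis mult.commute mult.left_commute)
    ultimately show ?thesis by (simp add: power2_eq_square algebra_simps)
  qed
  have "e * \<tau> \<le> (e0 + 4 * c * \<tau>) * \<tau>" using *[of "x + \<tau>"] \<open>0 < \<tau>\<close> by simp
  then have "e \<le> e0 + 4 * c * \<tau>" using \<open>0 < \<tau>\<close> mult_le_cancel_right_pos by blast
  moreover have "(e0 - 4 * c * \<tau>) * \<tau> \<le> e * \<tau>" using *[of "x - \<tau>"] \<open>0 < \<tau>\<close> by simp
  then have "e0 - 4 * c * \<tau> \<le> e" using \<open>0 < \<tau>\<close> mult_le_cancel_right_pos by blast
  ultimately show ?thesis by simp
qed

lemma superjet_add_parabola: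
  assumes "superjet f x d p"
  shows "superjet (\<lambda>y. f y + C / 2 * y\<^sup>2) x (d + C * x) (p + C)"
  using superjet_add[OF assms superjet_parabola[of "C/2" x]] by simp

text \<open>The one-dimensional theorem on sums. Both functions are convex up to a parabola, so at the
  maximum of the sum each is differentiable, and superjets at nearby points have nearby slopes.
  If all these superjets had second-order parts summing to more than \<open>\<eta>\<close>, then \<open>f\<close> and \<open>g\<close> would
  lie above parabolas whose sum opens upwards.\<close>
lemma theorem_on_sums:
  assumes contf: "continuous_on {l<..<r} f" and contg: "continuous_on {l<..<r} g"
    and jf: "\<And>x d p. x \<in> {l<..<r} \<Longrightarrow> superjet f x d p \<Longrightarrow> - C \<le> p"
    and jg: "\<And>x d p. x \<in> {l<..<r} \<Longrightarrow> superjet g x d p \<Longrightarrow> - C \<le> p"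
    and x0: "x0 \<in> {l<..<r}"
    and mx: "\<And>y. y \<in> {l<..<r} \<Longrightarrow> f y + g y \<le> f x0 + g x0"
    and \<eta>: "0 < \<eta>"
  obtains x d p x' d' p' where "x \<in> {l<..<r}" "x' \<in> {l<..<r}" "\<bar>x - x0\<bar> < \<eta>" "\<bar>x' - x0\<bar> < \<eta>"
    "superjet f x d p" "superjet g x' d' p'" "\<bar>d + d'\<bar> \<le> \<eta>" "p + p' \<le> \<eta>"
proof -
  have convex: "convex_on {l<..<r} (\<lambda>x. F x + max C 0 / 2 * x\<^sup>2)"
    if "continuous_on {l<..<r} F" and j: "\<And>x d p. x \<in> {l<..<r} \<Longrightarrow> superjet F x d p \<Longrightarrow> - C \<le> p" for F
  proof -
    have "- max C 0 \<le> p" if "x \<in> {l<..<r}" "superjet F x d p" for x d p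
      using j[OF that] by simp
    from convex_on_if_superjets_ge[OF \<open>continuous_on _ F\<close> this] show ?thesis by simp
  qed
  \<comment> \<open>Truncation at 0 supplies the nonnegative coefficient that
    \<open>superjet_slope_near\<close> asks for.\<close>
  define C' where "C' = max C 0"
  have C': "0 \<le> C'" by (simp add: C'_def)
  define kf where "kf = (\<lambda>x. f x + C' / 2 * x\<^sup>2)"
  define kg where "kg = (\<lambda>x. g x + C' / 2 * x\<^sup>2)"
  have ckf: "convex_on {l<..<r} kf" and ckg: "convex_on {l<..<r} kg"
    unfolding kf_def kg_def C'_def using convex[OF contf jf] convex[OF contg jg] by auto
  obtain e where e: "\<And>y. y \<in> {l<..<r} \<Longrightarrow> kf x0 + e * (y - x0) \<le> kf y"
    using convex_on_supporting_line[OF ckf x0] by blast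
  obtain e' where e': "\<And>y. y \<in> {l<..<r} \<Longrightarrow> kg x0 + e' * (y - x0) \<le> kg y"
    using convex_on_supporting_line[OF ckg x0] by blast
  have sq: "y\<^sup>2 = x0\<^sup>2 + 2 * x0 * (y - x0) + (y - x0)\<^sup>2" for y
    by (simp add: power2_eq_square algebra_simps)
  have sum: "kf y + kg y \<le> kf x0 + kg x0 + 2 * C' * x0 * (y - x0) + C' * (y - x0)\<^sup>2"
    if "y \<in> {l<..<r}" for y
    using mx[OF that] unfolding kf_def kg_def sq[of y] by (simp add: algebra_simps add_divide_distrib)
  have in_nhds: "\<forall>\<^sub>F y in nhds x0. y \<in> {l<..<r}"
    using x0 by (intro eventually_nhds_in_open) auto
  \<comment> \<open>First-order condition at the maximum: the two supporting lines together stay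
    below the upper parabola of \<open>kf + kg\<close> and touch it at \<open>x0\<close>, so the
    slopes match.\<close>
  have "superjet (\<lambda>y. 0) x0 (2 * C' * x0 - e - e') (2 * C')"
    unfolding superjet_def
    by (rule eventually_mono[OF in_nhds]) (use sum e e' in \<open>fastforce simp: algebra_simps\<close>)
  then have ee: "e + e' = 2 * C' * x0"
    using superjet_slope_le[of "\<lambda>_. 0" x0 "2 * C' * x0 - e - e'" "2 * C'" 0] by simp
  have ee1: "2 * C' * x0 * (y - x0) = e * (y - x0) + e' * (y - x0)" for y
    unfolding ee[symmetric] by (rule distrib_right)
  \<comment> \<open>Subtracting the other function's supporting line pinches each function between
    its own supporting line and a parabola.\<close>
  have upf: "kf y \<le> kf x0 + e * (y - x0) + C' * (y - x0)\<^sup>2" if "y \<in> {l<..<r}" for y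
    using sum[OF that] e'[OF that] ee1[of y] by linarith
  have upg: "kg y \<le> kg x0 + e' * (y - x0) + C' * (y - x0)\<^sup>2" if "y \<in> {l<..<r}" for y
    using sum[OF that] e[OF that] ee1[of y] by linarith
  have upf': "\<forall>y\<in>{l<..<r}. f y + C' / 2 * y\<^sup>2 \<le> f x0 + C' / 2 * x0\<^sup>2 + e * (y - x0) + C' * (y - x0)\<^sup>2"
    and lowf': "\<forall>y\<in>{l<..<r}. f x0 + C' / 2 * x0\<^sup>2 + e * (y - x0) \<le> f y + C' / 2 * y\<^sup>2"
    and upg': "\<forall>y\<in>{l<..<r}. g y + C' / 2 * y\<^sup>2 \<le> g x0 + C' / 2 * x0\<^sup>2 + e' * (y - x0) + C' * (y - x0)\<^sup>2"
    and lowg': "\<forall>y\<in>{l<..<r}. g x0 + C' / 2 * x0\<^sup>2 + e' * (y - x0) \<le> g y + C' / 2 * y\<^sup>2"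
    using upf e upg e' unfolding kf_def kg_def by blast+
  \<comment> \<open>The thirds keep the doubled interval inside \<open>{l<..<r}\<close>. The last
    entry makes the slope error \<open>5 * C' * \<tau>\<close> at most \<open>\<eta> / 2\<close>:
    four parts come from \<open>superjet_slope_near\<close>, one from removing the added
    parabola.\<close>
  define \<tau> where "\<tau> = Min {\<eta>, (x0 - l) / 3, (r - x0) / 3, \<eta> / (10 * (C' + 1))}"
  have \<tau>: "0 < \<tau>" using x0 \<eta> C' by (simp add: \<tau>_def)
  have \<tau>le: "\<tau> \<le> \<eta>" "\<tau> \<le> (x0 - l) / 3" "\<tau> \<le> (r - x0) / 3" "\<tau> \<le> \<eta> / (10 * (C' + 1))"
    unfolding \<tau>_def by (rule Min_le; simp)+
  have "10 * C' * \<tau> \<le> \<eta>"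
  proof -
    have "\<tau> * (10 * (C' + 1)) \<le> \<eta>" using \<tau>le(4) C' by (subst (asm) pos_le_divide_eq) auto
    then show ?thesis using \<tau> by (simp add: algebra_simps)
  qed
  have sub: "{x0 - 2 * \<tau>..x0 + 2 * \<tau>} \<subseteq> {l<..<r}" using \<tau>le x0 by auto
  have sub': "{x0 - \<tau><..<x0 + \<tau>} \<subseteq> {l<..<r}" using sub \<tau> by fastforce
  have slope: "\<bar>d - (e0 - C' * x0)\<bar> \<le> \<eta> / 2"
    if kc: "convex_on {l<..<r} (\<lambda>x. F x + C' / 2 * x\<^sup>2)"
      and up: "\<forall>y\<in>{l<..<r}. F y + C' / 2 * y\<^sup>2 \<le> F x0 + C' / 2 * x0\<^sup>2 + e0 * (y - x0) + C' * (y - x0)\<^sup>2"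
      and low: "\<forall>y\<in>{l<..<r}. F x0 + C' / 2 * x0\<^sup>2 + e0 * (y - x0) \<le> F y + C' / 2 * y\<^sup>2"
      and x: "\<bar>x - x0\<bar> < \<tau>" and j: "superjet F x d p" for F e0 x d p
  proof -
    have "\<bar>(d + C' * x) - e0\<bar> \<le> 4 * C' * \<tau>"
      by (rule superjet_slope_near[OF kc bspec[OF up] bspec[OF low] C' \<tau> sub x superjet_add_parabola[OF j]])
    moreover have "\<bar>C' * (x - x0)\<bar> \<le> C' * \<tau>"
      using x C' by (simp add: abs_mult mult_left_mono)
    ultimately have "\<bar>d - (e0 - C' * x0)\<bar> \<le> 5 * C' * \<tau>"
      by (simp add: algebra_simps)
    then show ?thesis using \<open>10 * C' * \<tau> \<le> \<eta>\<close> by linarith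
  qed
  note slopef = slope[OF ckf[unfolded kf_def] upf' lowf']
  note slopeg = slope[OF ckg[unfolded kg_def] upg' lowg']
  \<comment> \<open>\<open>F\<close> minus a parabola is convex near \<open>x0\<close>, and its
    tangent there has the slope already identified.\<close>
  have lower: "F x0 + (e0 - C' * x0) * (y - x0) + P / 2 * (y - x0)\<^sup>2 \<le> F y"
    if cont: "continuous_on {l<..<r} F"
      and up: "\<forall>y\<in>{l<..<r}. F y + C' / 2 * y\<^sup>2 \<le> F x0 + C' / 2 * x0\<^sup>2 + e0 * (y - x0) + C' * (y - x0)\<^sup>2"
      and P: "\<forall>x d p. \<bar>x - x0\<bar> < \<tau> \<longrightarrow> superjet F x d p \<longrightarrow> P \<le> p"
      and y: "y \<in> {x0 - \<tau><..<x0 + \<tau>}" for F e0 P y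
  proof -
    have k: "convex_on {x0 - \<tau><..<x0 + \<tau>} (\<lambda>x. F x - P / 2 * x\<^sup>2)"
    proof (rule convex_on_if_superjets_ge[OF continuous_on_subset[OF cont sub']])
      fix x d p assume "x \<in> {x0 - \<tau><..<x0 + \<tau>}" "superjet F x d p"
      then show "P \<le> p" using P[rule_format, of x d p] by (auto simp: abs_less_iff)
    qed
    have "superjet F x0 (e0 - C' * x0) C'"
      unfolding superjet_def
    proof (rule eventually_mono[OF in_nhds])
      fix y assume "y \<in> {l<..<r}"
      from bspec[OF up this] show "F y \<le> F x0 + (e0 - C' * x0) * (y - x0) + C' / 2 * (y - x0)\<^sup>2"
        unfolding sq[of y] by (simp add: algebra_simps add_divide_distrib)
    qed
    from superjet_add_parabola[OF this, of "- P"]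
    have j: "superjet (\<lambda>x. F x - P / 2 * x\<^sup>2) x0 (e0 - C' * x0 - P * x0) (C' - P)" by simp
    have "F x0 - P / 2 * x0\<^sup>2 + (e0 - C' * x0 - P * x0) * (y - x0) \<le> F y - P / 2 * y\<^sup>2"
      using convex_on_superjet_tangent[OF k _ j y] \<tau> by simp
    then show ?thesis unfolding sq[of y] by (simp add: algebra_simps add_divide_distrib)
  qed
  \<comment> \<open>The linear terms of the two lower parabolas cancel by \<open>ee\<close>, so a
    positive total curvature would push \<open>f + g\<close> above its maximum at any point beside
    \<open>x0\<close>.\<close>
  have sum0: "P + P' \<le> 0"
    if P: "\<forall>x d p. \<bar>x - x0\<bar> < \<tau> \<longrightarrow> superjet f x d p \<longrightarrow> P \<le> p"
      and P': "\<forall>x d p. \<bar>x - x0\<bar> < \<tau> \<longrightarrow> superjet g x d p \<longrightarrow> P' \<le> p" for P P'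
  proof -
    define y where "y = x0 + \<tau> / 2"
    have y: "y \<in> {x0 - \<tau><..<x0 + \<tau>}" using \<tau> by (simp add: y_def)
    have "f x0 + (e - C' * x0) * (y - x0) + P / 2 * (y - x0)\<^sup>2 \<le> f y"
      by (rule lower[OF contf upf' P y])
    moreover have "g x0 + (e' - C' * x0) * (y - x0) + P' / 2 * (y - x0)\<^sup>2 \<le> g y"
      by (rule lower[OF contg upg' P' y])
    moreover have "f y + g y \<le> f x0 + g x0" by (rule mx[OF subsetD[OF sub' y]])
    moreover have "(e - C' * x0) * (y - x0) + (e' - C' * x0) * (y - x0) = (e + e' - 2 * C' * x0) * (y - x0)"
      by (simp add: algebra_simps)
    then have "(e - C' * x0) * (y - x0) + (e' - C' * x0) * (y - x0) = 0" by (simp add: ee)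
    ultimately have "P / 2 * (y - x0)\<^sup>2 + P' / 2 * (y - x0)\<^sup>2 \<le> 0" by linarith
    then have "(P + P') / 2 * (y - x0)\<^sup>2 \<le> 0" by (simp add: distrib_right add_divide_distrib)
    moreover have "0 < (y - x0)\<^sup>2" using \<tau> by (simp add: y_def)
    ultimately show ?thesis by (simp add: mult_le_0_iff)
  qed
  have xin: "x \<in> {l<..<r}" if "\<bar>x - x0\<bar> < \<tau>" for x
    by (rule subsetD[OF sub']) (use that in \<open>auto simp: abs_less_iff\<close>)
  \<comment> \<open>If every pair summed to more than \<open>\<eta>\<close>, then
    \<open>Inf S\<close> for \<open>f\<close> and \<open>\<eta> - Inf S\<close> for \<open>g\<close>
    would be lower bounds with positive sum, against \<open>sum0\<close>. For empty
    \<open>S\<close>, the number \<open>C + 1\<close> bounds vacuously and beats the bound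
    \<open>- C\<close> of \<open>g\<close>.\<close>
  define S where "S = {p. \<exists>x d. \<bar>x - x0\<bar> < \<tau> \<and> superjet f x d p}"
  have "\<exists>x d p x' d' p'. \<bar>x - x0\<bar> < \<tau> \<and> superjet f x d p \<and> \<bar>x' - x0\<bar> < \<tau> \<and> superjet g x' d' p' \<and> p + p' \<le> \<eta>"
  proof (rule ccontr)
    assume "\<not> ?thesis"
    then have no: "\<eta> < p + p'" if "\<bar>x - x0\<bar> < \<tau>" "superjet f x d p" "\<bar>x' - x0\<bar> < \<tau>" "superjet g x' d' p'"
      for x d p x' d' p' using that by (meson not_le)
    show False
    proof (cases "S = {}")
      case True
      have "(C + 1) + (- C) \<le> 0"
      proof (rule sum0; intro allI impI)
        show "C + 1 \<le> p" if "\<bar>x - x0\<bar> < \<tau>" "superjet f x d p" for x d p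
          using True that by (auto simp: S_def)
        show "- C \<le> p" if "\<bar>x - x0\<bar> < \<tau>" "superjet g x d p" for x d p
          using jg[OF xin] that by blast
      qed
      then show False by simp
    next
      case False
      have bdd: "bdd_below S" using jf xin by (intro bdd_belowI[of _ "- C"]) (auto simp: S_def)
      have "Inf S + (\<eta> - Inf S) \<le> 0"
      proof (rule sum0; intro allI impI)
        show "Inf S \<le> p" if "\<bar>x - x0\<bar> < \<tau>" "superjet f x d p" for x d p
          using bdd that by (intro cInf_lower) (auto simp: S_def)
        show "\<eta> - Inf S \<le> p'" if "\<bar>x' - x0\<bar> < \<tau>" "superjet g x' d' p'" for x' d' p'
        proof -
          have "\<eta> - p' \<le> Inf S"
          proof (rule cInf_greatest[OF False])
            fix p assume "p \<in> S"
            then obtain x d where "\<bar>x - x0\<bar> < \<tau>" "superjet f x d p" by (auto simp: S_def)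
            from no[OF this that] show "\<eta> - p' \<le> p" by simp
          qed
          then show ?thesis by simp
        qed
      qed
      then show False using \<eta> by simp
    qed
  qed
  then obtain x d p x' d' p' where 1: "\<bar>x - x0\<bar> < \<tau>" "superjet f x d p" "\<bar>x' - x0\<bar> < \<tau>"
    "superjet g x' d' p'" "p + p' \<le> \<eta>" by blast
  have "\<bar>d + d'\<bar> \<le> \<eta>" using slopef[OF 1(1,2)] slopeg[OF 1(3,4)] ee by linarith
  then show ?thesis using that[of x x' d p d' p'] 1 xin \<tau>le(1) by auto
qed

section \<open>Test functions and jumps\<close>

text \<open>These are the test functions used below: \<open>3 \<le> m\<close> makes the power vanish
  at \<open>x\<close> together with its first two derivatives.\<close>

lemma quadratic_plus_power_derivs:
  fixes A c d p K x :: real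
  assumes m: "3 \<le> m"
  defines "\<Phi> \<equiv> \<lambda>y. c + d * (y - x) + p / 2 * (y - x)\<^sup>2 + K * (y - x) ^ m"
  shows "C2_on S \<Phi>" "deriv \<Phi> x = d" "deriv (deriv \<Phi>) x = p"
proof -
  define \<Phi>' where "\<Phi>' = (\<lambda>y. d + p * (y - x) + K * (real m * (y - x) ^ (m - 1)))"
  define \<Phi>'' where "\<Phi>'' = (\<lambda>y. p + K * (real m * (real (m - 1) * (y - x) ^ (m - 2))))"
  have D1: "(\<Phi> has_real_derivative \<Phi>' y) (at y)" for y
    unfolding \<Phi>_def \<Phi>'_def by (auto intro!: derivative_eq_intros)
  have D2: "(\<Phi>' has_real_derivative \<Phi>'' y) (at y)" for y
    unfolding \<Phi>'_def \<Phi>''_def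
    by (auto intro!: derivative_eq_intros simp: diff_diff_left numeral_2_eq_2)
  have "continuous_on S \<Phi>''" unfolding \<Phi>''_def by (intro continuous_intros)
  with D1 D2 show "C2_on S \<Phi>" unfolding C2_on_def by blast
  have d: "deriv \<Phi> = \<Phi>'" using D1 DERIV_imp_deriv by blast
  show "deriv \<Phi> x = d" using m by (simp add: d \<Phi>'_def)
  show "deriv (deriv \<Phi>) x = p" using m DERIV_imp_deriv[OF D2] by (simp add: d \<Phi>''_def)
qed

text \<open>A high even power makes a local quadratic bound global without changing the 2-jet.\<close>
lemma superjet_global_bound:
  assumes pg: "polynomial_growth w" and x: "0 < x" and j: "superjet w x d p"
  obtains K m where "3 \<le> m" "\<And>y. 0 < y \<Longrightarrow> w y \<le> w x + d * (y - x) + p / 2 * (y - x)\<^sup>2 + K * (y - x) ^ m"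
proof -
  obtain C n where C: "\<And>y. 0 \<le> y \<Longrightarrow> \<bar>w y\<bar> \<le> C * (1 + y ^ n)"
    using pg unfolding polynomial_growth_def by blast
  have "0 \<le> C * (1 + 1 ^ n)" using C[of 1] by linarith
  then have C0: "0 \<le> C" by (simp add: zero_le_mult_iff)
  obtain \<delta> where \<delta>: "\<delta> > 0"
    "\<And>y. dist y x < \<delta> \<Longrightarrow> w y \<le> w x + d * (y - x) + p / 2 * (y - x)\<^sup>2"
    using j by (auto simp: superjet_def eventually_nhds_metric)
  \<comment> \<open>Even, so the correction is nonnegative on both sides of \<open>x\<close>, and
    large enough to dominate the growth of \<open>w\<close>, the slope and the curvature term.
    \<open>A\<close> adds up the sizes of these terms at distance \<open>\<delta>\<close>;
    \<open>K\<close> is scaled so that the correction is \<open>A * T ^ m\<close>, where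
    \<open>T\<close> is the distance in units of \<open>\<delta>\<close>.\<close>
  define m where "m = 2 * (n + 2)"
  define A where "A = C * (1 + (x + \<delta>) ^ n) + \<bar>w x\<bar> + \<bar>d\<bar> * \<delta> + \<bar>p\<bar> * \<delta>\<^sup>2"
  have A: "0 \<le> A" using C0 x \<delta>(1) by (auto simp: A_def)
  define K where "K = A / \<delta> ^ m"
  have K: "0 \<le> K" using A \<delta>(1) by (simp add: K_def)
  show thesis
  proof
    show "3 \<le> m" by (simp add: m_def)
    fix y :: real assume y: "0 < y"
    show "w y \<le> w x + d * (y - x) + p / 2 * (y - x)\<^sup>2 + K * (y - x) ^ m"
    proof (cases "dist y x < \<delta>")
      case True
      have "0 \<le> K * (y - x) ^ m" using K unfolding m_def by (intro mult_nonneg_nonneg zero_le_even_power) auto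
      then show ?thesis using \<delta>(2)[OF True] by linarith
    next
      case False
      define T where "T = \<bar>y - x\<bar> / \<delta>"
      have yx: "\<bar>y - x\<bar> = \<delta> * T" using \<delta>(1) by (simp add: T_def)
      have T: "1 \<le> T" using False \<delta>(1) by (simp add: T_def dist_real_def)
      have pw: "T ^ k \<le> T ^ m" if "k \<le> m" for k using T that by (rule power_increasing[rotated])
      have T1: "1 \<le> T ^ m" using T by (rule one_le_power)
      have T2: "T \<le> T ^ m" using pw[of 1] by (simp add: m_def)
      have "x * 1 \<le> x * T" using T x by (intro mult_left_mono) auto
      then have "y \<le> x * T + \<delta> * T" using yx by linarith
      then have "y ^ n \<le> ((x + \<delta>) * T) ^ n"
        using y by (intro power_mono) (auto simp: algebra_simps)
      also have "\<dots> \<le> (x + \<delta>) ^ n * T ^ m"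
        using pw[of n] x \<delta>(1) by (simp add: power_mult_distrib mult_left_mono m_def)
      finally have "1 + y ^ n \<le> (1 + (x + \<delta>) ^ n) * T ^ m"
        using T1 by (simp add: algebra_simps)
      then have "C * (1 + y ^ n) \<le> C * (1 + (x + \<delta>) ^ n) * T ^ m"
        using C0 by (simp add: mult.assoc mult_left_mono)
      then have 1: "w y \<le> C * (1 + (x + \<delta>) ^ n) * T ^ m" using C[of y] y by simp
      have "\<bar>w x\<bar> * 1 \<le> \<bar>w x\<bar> * T ^ m" using T1 by (intro mult_left_mono) auto
      then have 2: "- w x \<le> \<bar>w x\<bar> * T ^ m" by linarith
      have "- (d * (y - x)) \<le> \<bar>d\<bar> * \<bar>y - x\<bar>" by (metis abs_ge_minus_self abs_mult)
      also have "\<dots> \<le> \<bar>d\<bar> * \<delta> * T ^ m"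
        unfolding yx using T2 \<delta>(1) by (simp add: mult.assoc mult_left_mono)
      finally have 3: "- (d * (y - x)) \<le> \<bar>d\<bar> * \<delta> * T ^ m" .
      have "- (p / 2) * (y - x)\<^sup>2 \<le> \<bar>p\<bar> * (y - x)\<^sup>2"
        by (intro mult_right_mono) auto
      then have "- (p / 2 * (y - x)\<^sup>2) \<le> \<bar>p\<bar> * \<bar>y - x\<bar>\<^sup>2" by simp
      also have "\<dots> = \<bar>p\<bar> * \<delta>\<^sup>2 * T ^ 2" unfolding yx by (simp add: power_mult_distrib)
      also have "\<dots> \<le> \<bar>p\<bar> * \<delta>\<^sup>2 * T ^ m" using pw[of 2] by (simp add: mult_left_mono m_def)
      finally have 4: "- (p / 2 * (y - x)\<^sup>2) \<le> \<bar>p\<bar> * \<delta>\<^sup>2 * T ^ m" .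
      have "K * (y - x) ^ m = K * \<bar>y - x\<bar> ^ m" by (simp add: m_def power_mult)
      also have "\<dots> = A * T ^ m" unfolding yx using \<delta>(1) by (simp add: K_def power_mult_distrib)
      also have "\<dots> = C * (1 + (x + \<delta>) ^ n) * T ^ m + \<bar>w x\<bar> * T ^ m + \<bar>d\<bar> * \<delta> * T ^ m + \<bar>p\<bar> * \<delta>\<^sup>2 * T ^ m"
        by (simp add: A_def algebra_simps)
      finally show ?thesis using 1 2 3 4 by linarith
    qed
  qed
qed

section \<open>The differential and obstacle inequalities read off from superjets\<close>

lemma L_op_eq:
  "L_op a \<mu>p \<mu>m \<sigma>p \<sigma>m q u f x =
     1/2 * (if x > a then \<sigma>p else \<sigma>m)\<^sup>2 * u\<^sup>2 * deriv (deriv f) x + (if x > a then \<mu>p else \<mu>m) * u * deriv f x - q * f x"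
  by (auto simp: L_op_def indicator_def)

lemma continuous_on_M_op:
  assumes "continuous_on {0..} (w :: real \<Rightarrow> real)"
  shows "continuous_on {0..x} (\<lambda>\<eta>. w (x - \<eta>) + \<eta> - \<beta>)"
  by (intro continuous_intros continuous_on_compose2[OF assms]) auto

text \<open>Continuity on a compact interval turns the supremum into a maximum, so strictness
  survives.\<close>

lemma M_op_neg:
  assumes "continuous_on {0..} w" "0 \<le> x" and j: "\<And>z. z \<in> {0..x} \<Longrightarrow> w z + x - z - \<beta> < w x"
  shows "M_op \<beta> w x < 0"
proof -
  obtain \<eta> where \<eta>: "\<eta> \<in> {0..x}"
    "\<And>\<eta>'. \<eta>' \<in> {0..x} \<Longrightarrow> w (x - \<eta>') + \<eta>' - \<beta> \<le> w (x - \<eta>) + \<eta> - \<beta>"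
    using continuous_attains_sup[OF _ _ continuous_on_M_op[OF assms(1)], of x \<beta>] assms(2) by auto
  have "(SUP \<eta>\<in>{0..x}. w (x - \<eta>) + \<eta> - \<beta>) \<le> w (x - \<eta>) + \<eta> - \<beta>"
    by (rule cSUP_least) (use \<eta> assms(2) in auto)
  also have "\<dots> < w x" using j[of "x - \<eta>"] \<eta>(1) by simp
  finally show ?thesis by (simp add: M_op_def)
qed

lemma M_op_nonpos_imp:
  assumes "continuous_on {0..} w" "M_op \<beta> w x \<le> 0" "z \<in> {0..x}"
  shows "w z + x - z - \<beta> \<le> w x"
proof -
  have "compact ((\<lambda>\<eta>. w (x - \<eta>) + \<eta> - \<beta>) ` {0..x})"
    by (intro compact_continuous_image continuous_on_M_op assms) simp
  then have "bdd_above ((\<lambda>\<eta>. w (x - \<eta>) + \<eta> - \<beta>) ` {0..x})"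
    by (intro bounded_imp_bdd_above compact_imp_bounded)
  from cSUP_upper[OF _ this, of "x - z"] have "w z + (x - z) - \<beta> \<le> (SUP \<eta>\<in>{0..x}. w (x - \<eta>) + \<eta> - \<beta>)"
    using assms(3) by simp
  then show ?thesis using assms(2) by (simp add: M_op_def)
qed

lemma continuous_on_L_op: "continuous_on {0..1} (\<lambda>u. L_op a \<mu>p \<mu>m \<sigma>p \<sigma>m q u f x)"
  unfolding L_op_def by (intro continuous_intros)

text \<open>Without a profitable jump the obstacle part is strictly negative, so the nonnegative
  maximum comes from the differential part; compactness of the control set then yields a single
  \<open>u\<close>.\<close>

lemma subsolution_superjet:
  assumes sub: "viscosity_subsolution a \<mu>p \<mu>m \<sigma>p \<sigma>m q \<beta> w" and pg: "polynomial_growth w"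
    and x: "0 < x" and no_jump: "\<And>z. z \<in> {0..x} \<Longrightarrow> w z + x - z - \<beta> < w x"
    and jet: "superjet w x d p"
  obtains u where "u \<in> {0..1}"
    "q * w x \<le> 1/2 * (if x > a then \<sigma>p else \<sigma>m)\<^sup>2 * u\<^sup>2 * p + (if x > a then \<mu>p else \<mu>m) * u * d"
proof -
  obtain K m where m: "3 \<le> m"
    and bd: "\<And>y. 0 < y \<Longrightarrow> w y \<le> w x + d * (y - x) + p / 2 * (y - x)\<^sup>2 + K * (y - x) ^ m"
    using superjet_global_bound[OF pg x jet] by blast
  define \<Phi> where "\<Phi> = (\<lambda>y. w x + d * (y - x) + p / 2 * (y - x)\<^sup>2 + K * (y - x) ^ m)"
  note \<Phi> = quadratic_plus_power_derivs[OF m, where c = "w x" and d = d and x = x and p = p and K = K, folded \<Phi>_def]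
  have \<Phi>x: "\<Phi> x = w x" using m by (simp add: \<Phi>_def)
  have cont: "continuous_on {0..} w" using sub by (simp add: viscosity_subsolution_def)
  have "\<forall>y>0. w y \<le> \<Phi> y" using bd by (simp add: \<Phi>_def)
  then have "0 \<le> HJB_lhs a \<mu>p \<mu>m \<sigma>p \<sigma>m q \<beta> \<Phi> w x"
    using sub \<Phi>(1)[of "{0<..}"] \<Phi>x x unfolding viscosity_subsolution_def by simp
  then have 0: "0 \<le> (SUP u\<in>{0..1}. L_op a \<mu>p \<mu>m \<sigma>p \<sigma>m q u \<Phi> x)"
    using M_op_neg[OF cont _ no_jump] x by (simp add: HJB_lhs_def)
  obtain u where u: "u \<in> {0..1}"
    "\<And>u'. u' \<in> {0..1} \<Longrightarrow> L_op a \<mu>p \<mu>m \<sigma>p \<sigma>m q u' \<Phi> x \<le> L_op a \<mu>p \<mu>m \<sigma>p \<sigma>m q u \<Phi> x"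
    using continuous_attains_sup[OF _ _ continuous_on_L_op[of a \<mu>p \<mu>m \<sigma>p \<sigma>m q \<Phi> x]] by auto
  note 0
  also have "(SUP u\<in>{0..1}. L_op a \<mu>p \<mu>m \<sigma>p \<sigma>m q u \<Phi> x) \<le> L_op a \<mu>p \<mu>m \<sigma>p \<sigma>m q u \<Phi> x"
    by (rule cSUP_least) (use u in auto)
  finally show thesis using that[OF u(1)] unfolding L_op_eq \<Phi> \<Phi>x by simp
qed

text \<open>A superjet of \<open>- w\<close> gives a test function below \<open>w\<close> with slope
  \<open>- d\<close> and curvature \<open>- p\<close>. Both parts of a nonpositive maximum are
  nonpositive, so every control and every jump can be used.\<close>

lemma supersolution_superjet:
  assumes super: "viscosity_supersolution a \<mu>p \<mu>m \<sigma>p \<sigma>m q \<beta> w" and pg: "polynomial_growth w"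
    and x: "0 < x" "x \<noteq> a" and jet: "superjet (\<lambda>y. - w y) x d p"
  shows "u \<in> {0..1} \<Longrightarrow>
      - (1/2 * (if x > a then \<sigma>p else \<sigma>m)\<^sup>2 * u\<^sup>2 * p + (if x > a then \<mu>p else \<mu>m) * u * d) \<le> q * w x"
    and "z \<in> {0..x} \<Longrightarrow> w z + x - z - \<beta> \<le> w x"
proof -
  have "polynomial_growth (\<lambda>y. - w y)" using pg by (simp add: polynomial_growth_def)
  from superjet_global_bound[OF this x(1) jet] obtain K m where m: "3 \<le> m"
    and bd: "\<And>y. 0 < y \<Longrightarrow> - w y \<le> - w x + d * (y - x) + p / 2 * (y - x)\<^sup>2 + K * (y - x) ^ m"
    by blast
  define \<Phi> where "\<Phi> = (\<lambda>y. w x + - d * (y - x) + - p / 2 * (y - x)\<^sup>2 + - K * (y - x) ^ m)"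
  note \<Phi> = quadratic_plus_power_derivs[OF m, where c = "w x" and d = "- d" and x = x and p = "- p" and K = "- K", folded \<Phi>_def]
  have \<Phi>x: "\<Phi> x = w x" using m by (simp add: \<Phi>_def)
  have cont: "continuous_on {0..} w" using super by (simp add: viscosity_supersolution_def)
  have "\<forall>y>0. \<Phi> y \<le> w y" using bd by (simp add: \<Phi>_def algebra_simps)
  moreover have "x \<in> {0<..<a} \<union> {a<..}" using x by auto
  ultimately have "HJB_lhs a \<mu>p \<mu>m \<sigma>p \<sigma>m q \<beta> \<Phi> w x \<le> 0"
    using super \<Phi>(1)[of "{0<..}"] \<Phi>x unfolding viscosity_supersolution_def by simp
  then have L: "(SUP u\<in>{0..1}. L_op a \<mu>p \<mu>m \<sigma>p \<sigma>m q u \<Phi> x) \<le> 0" and M: "M_op \<beta> w x \<le> 0"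
    by (auto simp: HJB_lhs_def)
  show "w z + x - z - \<beta> \<le> w x" if "z \<in> {0..x}"
    using M_op_nonpos_imp[OF cont M that] .
  assume u: "u \<in> {0..1}"
  have "compact ((\<lambda>u. L_op a \<mu>p \<mu>m \<sigma>p \<sigma>m q u \<Phi> x) ` {0..1})"
    by (intro compact_continuous_image continuous_on_L_op) simp
  then have "bdd_above ((\<lambda>u. L_op a \<mu>p \<mu>m \<sigma>p \<sigma>m q u \<Phi> x) ` {0..1})"
    by (intro bounded_imp_bdd_above compact_imp_bounded)
  from cSUP_upper[OF u this] L have "L_op a \<mu>p \<mu>m \<sigma>p \<sigma>m q u \<Phi> x \<le> 0" by simp
  then show "- (1/2 * (if x > a then \<sigma>p else \<sigma>m)\<^sup>2 * u\<^sup>2 * p + (if x > a then \<mu>p else \<mu>m) * u * d) \<le> q * w x"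
    unfolding L_op_eq \<Phi> \<Phi>x by (simp split: if_splits)
qed

text \<open>The obstacle inequality is only available where a parabola touches \<open>w\<close> from below; such
  points are dense, and the inequality passes to the limit.\<close>
lemma supersolution_jump:
  assumes super: "viscosity_supersolution a \<mu>p \<mu>m \<sigma>p \<sigma>m q \<beta> w" and pg: "polynomial_growth w"
    and nn: "\<And>x. 0 \<le> x \<Longrightarrow> 0 \<le> w x" and \<beta>: "0 \<le> \<beta>" and z: "0 \<le> z" "z \<le> x"
  shows "w z + x - z - \<beta> \<le> w x"
proof (cases "z = x")
  case True
  then show ?thesis using \<beta> by simp
next
  case False
  then have zx: "z < x" using z by simp
  have cont: "continuous_on {0..} w" using super by (simp add: viscosity_supersolution_def)
  have dense: "\<exists>y\<in>{s<..<t}. w z + y - z - \<beta> \<le> w y" if st: "z < s" "s < t" for s t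
  proof -
    \<comment> \<open>stay on one side of \<open>a\<close>, where the supersolution is not tested\<close>
    obtain s' t' where s': "s' < t'" "s \<le> s'" "t' \<le> t" "a \<notin> {s'<..<t'}"
    proof (cases "a \<in> {s<..<t}")
      case True then show ?thesis using that[of a t] by auto
    next
      case False then show ?thesis using that[of s t] st by auto
    qed
    \<comment> \<open>The penalty with coefficient \<open>K\<close> is \<open>w c + 1\<close> at
      both ends and 0 at the midpoint \<open>c\<close>. As \<open>w\<close> is nonnegative, the
      penalized minimum is interior, and there a parabola touches \<open>w\<close> from
      below.\<close>
    define c where "c = (s' + t') / 2"
    define K where "K = (w c + 1) / (t' - c)\<^sup>2"
    have c: "s' < c" "c < t'" "c - s' = t' - c" using s'(1) by (auto simp: c_def field_simps)
    have wc: "0 \<le> w c" using nn c s' st z by auto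
    have "continuous_on {s'..t'} (\<lambda>y. w y + K * (y - c)\<^sup>2)"
      using s' st z by (intro continuous_intros continuous_on_subset[OF cont]) auto
    then obtain y where y: "y \<in> {s'..t'}"
      "\<And>y'. y' \<in> {s'..t'} \<Longrightarrow> w y + K * (y - c)\<^sup>2 \<le> w y' + K * (y' - c)\<^sup>2"
      using continuous_attains_inf[of "{s'..t'}" "\<lambda>y. w y + K * (y - c)\<^sup>2"] s'(1) by auto
    have wy: "0 \<le> w y" using nn y(1) s' st z by auto
    have "K * (y - c)\<^sup>2 \<le> w c" using y(2)[of c] c wy by simp
    also have "\<dots> < K * (t' - c)\<^sup>2" using c by (simp add: K_def)
    finally have ne: "y \<noteq> s'" "y \<noteq> t'" using c by (auto simp: power2_commute[of s' c])
    then have yin: "y \<in> {s'<..<t'}" using y(1) by auto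
    have "superjet (\<lambda>y. - w y) y (2 * K * (y - c)) (2 * K)"
      unfolding superjet_def
    proof (rule eventually_mono)
      show "\<forall>\<^sub>F y' in nhds y. y' \<in> {s'<..<t'}"
        using yin by (intro eventually_nhds_in_open) auto
      fix y' assume "y' \<in> {s'<..<t'}"
      then have "w y + K * (y - c)\<^sup>2 \<le> w y' + K * (y' - c)\<^sup>2" using y(2) by auto
      then show "- w y' \<le> - w y + 2 * K * (y - c) * (y' - y) + 2 * K / 2 * (y' - y)\<^sup>2"
        by (simp add: power2_eq_square algebra_simps)
    qed
    from supersolution_superjet(2)[OF super pg _ _ this, of z]
    have "w z + y - z - \<beta> \<le> w y" using yin s' st z by auto
    then show ?thesis using yin s' by (intro bexI[of _ y]) auto
  qed
  \<comment> \<open>By continuity a violation at \<open>x\<close> would persist slightly to the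
    right of \<open>x\<close>, where \<open>dense\<close> supplies a point without
    violation.\<close>
  show ?thesis
  proof (rule ccontr)
    assume contr: "\<not> ?thesis"
    define g where "g = (\<lambda>y. w z + y - z - \<beta> - w y)"
    have "continuous_on {z<..} g" unfolding g_def
      using z by (intro continuous_intros continuous_on_subset[OF cont]) auto
    then have "isCont g x" using zx by (simp add: continuous_on_eq_continuous_at)
    moreover have "0 < g x" using contr by (simp add: g_def)
    ultimately have "\<forall>\<^sub>F y in nhds x. 0 < g y"
      by (auto simp: isCont_def tendsto_at_iff_tendsto_nhds intro: order_tendstoD(1))
    then obtain \<epsilon> where \<epsilon>: "\<epsilon> > 0" "\<And>y. dist y x < \<epsilon> \<Longrightarrow> 0 < g y"
      by (auto simp: eventually_nhds_metric)
    obtain y where "y \<in> {x<..<x + \<epsilon>}" "w z + y - z - \<beta> \<le> w y"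
      using dense[of x "x + \<epsilon>"] zx \<epsilon>(1) by auto
    then show False using \<epsilon>(2)[of y] by (auto simp: g_def dist_real_def)
  qed
qed

section \<open>The maximum principle within one regime\<close>

lemma superjet_slope_le_lipschitz:
  assumes "superjet f x d p" "L-lipschitz_on S f" "open S" "x \<in> S"
  shows "\<bar>d\<bar> \<le> L"
proof (rule superjet_slope_le[OF assms(1)], rule eventually_mono)
  show "\<forall>\<^sub>F y in nhds x. y \<in> S" using assms(3,4) by (rule eventually_nhds_in_open)
  fix y assume "y \<in> S"
  then have "dist (f x) (f y) \<le> L * dist x y" using lipschitz_onD[OF assms(2,4)] by blast
  then show "f x - L * \<bar>y - x\<bar> \<le> f y" by (simp add: dist_real_def abs_minus_commute)
qed

lemma LIMSEQ_if_dist_less_inverse: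
  fixes X :: "nat \<Rightarrow> real"
  assumes "\<And>n. \<bar>X n - x0\<bar> < 1 / (real n + 1)"
  shows "X \<longlonglongrightarrow> x0"
proof (rule LIM_zero_cancel, rule Lim_null_comparison)
  show "\<forall>\<^sub>F n in sequentially. norm (X n - x0) \<le> 1 / real (Suc n)"
    using assms by (intro always_eventually) (auto simp: less_imp_le add.commute)
  show "(\<lambda>n. 1 / real (Suc n)) \<longlonglongrightarrow> 0" using LIMSEQ_inverse_real_of_nat by (simp add: inverse_eq_divide)
qed

lemma mult_le_abs_mult:
  fixes a b c :: real
  assumes "\<bar>b\<bar> \<le> c"
  shows "a * b \<le> \<bar>a\<bar> * c"
proof -
  have "a * b \<le> \<bar>a\<bar> * \<bar>b\<bar>" by (metis abs_ge_self abs_mult)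
  also have "\<dots> \<le> \<bar>a\<bar> * c" using assms by (intro mult_left_mono) auto
  finally show ?thesis .
qed

text \<open>Ellipticity: a superjet of \<open>v1\<close> needs \<open>u\<close> bounded away from 0 to make up for \<open>q * v1\<close> by a
  bounded slope, and then \<open>p\<close> cannot be very negative.\<close>
lemma curvature_lower_bound:
  fixes q m \<sigma> \<mu> L u d p :: real
  assumes "0 < q" "0 < m" "0 < \<sigma>" "u \<in> {0..1}" "\<bar>d\<bar> \<le> L"
    and ineq: "q * m \<le> 1/2 * \<sigma>\<^sup>2 * u\<^sup>2 * p + \<mu> * u * d"
  shows "- (2 * \<bar>\<mu>\<bar> * L / (\<sigma>\<^sup>2 * (q * m / (\<bar>\<mu>\<bar> * L + 1))\<^sup>2)) \<le> p"
proof -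
  have L: "0 \<le> \<bar>\<mu>\<bar> * L" using assms(5) by (intro mult_nonneg_nonneg) auto
  \<comment> \<open>For negative \<open>p\<close> the drift alone has to reach \<open>q * m\<close>,
    which forces \<open>u0 \<le> u\<close>. The added 1 keeps the denominator positive.\<close>
  define u0 where "u0 = q * m / (\<bar>\<mu>\<bar> * L + 1)"
  have u0: "0 < u0" using assms L by (simp add: u0_def add_nonneg_pos)
  have "\<mu> * d \<le> \<bar>\<mu>\<bar> * L"
    using assms(5) by (rule mult_le_abs_mult)
  then have drift: "\<mu> * u * d \<le> u * (\<bar>\<mu>\<bar> * L)"
    using assms(4) mult_left_mono[of "\<mu> * d" "\<bar>\<mu>\<bar> * L" u] by (simp add: algebra_simps)
  have drift1: "u * (\<bar>\<mu>\<bar> * L) \<le> \<bar>\<mu>\<bar> * L" using assms(4) L mult_right_mono[of u 1] by fastforce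
  show ?thesis
  proof (cases "0 \<le> p")
    case True
    have "0 \<le> 2 * \<bar>\<mu>\<bar> * L / (\<sigma>\<^sup>2 * (q * m / (\<bar>\<mu>\<bar> * L + 1))\<^sup>2)"
    proof (rule divide_nonneg_nonneg)
      show "0 \<le> 2 * \<bar>\<mu>\<bar> * L" using L by linarith
    qed simp
    with True show ?thesis by linarith
  next
    case False
    then have np: "1/2 * \<sigma>\<^sup>2 * u\<^sup>2 * p \<le> 0" by (intro mult_nonneg_nonpos) auto
    then have "q * m \<le> u * (\<bar>\<mu>\<bar> * L + 1)" using ineq drift assms(4) by (simp add: algebra_simps)
    then have "u0 \<le> u" unfolding u0_def using L by (subst pos_divide_le_eq) auto
    then have "u0\<^sup>2 \<le> u\<^sup>2" using u0 by (intro power_mono) auto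
    then have "1/2 * \<sigma>\<^sup>2 * u\<^sup>2 * p \<le> 1/2 * \<sigma>\<^sup>2 * u0\<^sup>2 * p"
      using False by (intro mult_right_mono_neg mult_left_mono) auto
    moreover have "0 < q * m" using assms by simp
    ultimately have "- (2 * \<bar>\<mu>\<bar> * L) \<le> p * (\<sigma>\<^sup>2 * u0\<^sup>2)" using ineq drift drift1 by (simp add: algebra_simps)
    moreover have "0 < \<sigma>\<^sup>2 * u0\<^sup>2" using u0 assms by simp
    ultimately show ?thesis unfolding u0_def[symmetric]
      by (simp only: minus_divide_left pos_divide_le_eq)
  qed
qed

text \<open>\<open>theorem_on_sums\<close> is applied to \<open>v1\<close> and
  \<open>- v2 - s\<close>. Inserting the control selected by the subsolution into the supersolution
  inequality and subtracting leaves, in the limit, only the first- and second-order terms of the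
  penalty \<open>s\<close>. The constant \<open>\<sigma>\<close> and \<open>\<mu>\<close> correspond
  to staying on one side of \<open>a\<close>.\<close>

lemma max_principle:
  fixes v1 v2 s s1 c :: "real \<Rightarrow> real" and q \<sigma> \<mu> :: real
  assumes q: "0 < q" and \<sigma>: "0 < \<sigma>" and I: "x0 \<in> I" "open I"
    and lip1: "locally_lipschitz_on I v1" and lip2: "locally_lipschitz_on I v2"
    and sub: "\<And>x d p. x \<in> I \<Longrightarrow> superjet v1 x d p \<Longrightarrow>
      \<exists>u\<in>{0..1}. q * v1 x \<le> 1/2 * \<sigma>\<^sup>2 * u\<^sup>2 * p + \<mu> * u * d"
    and super: "\<And>x d p u. x \<in> I \<Longrightarrow> superjet (\<lambda>y. - v2 y) x d p \<Longrightarrow> u \<in> {0..1} \<Longrightarrow>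
      - (1/2 * \<sigma>\<^sup>2 * u\<^sup>2 * p + \<mu> * u * d) \<le> q * v2 x"
    and conts: "continuous_on I s" and js: "\<And>x. x \<in> I \<Longrightarrow> superjet s x (s1 x) (c x)"
    and conts1: "isCont s1 x0" and contc: "isCont c x0"
    and mx: "\<And>y. y \<in> I \<Longrightarrow> v1 y - v2 y - s y \<le> v1 x0 - v2 x0 - s x0"
    and pos: "0 < v1 x0"
  shows "q * (v1 x0 - v2 x0) \<le> \<bar>\<mu>\<bar> * \<bar>s1 x0\<bar> + 1/2 * \<sigma>\<^sup>2 * \<bar>c x0\<bar>"
proof -
  obtain e1 L1 where e1: "0 < e1" "L1-lipschitz_on (ball x0 e1 \<inter> I) v1"
    using lip1 I(1) unfolding locally_lipschitz_on_def by blast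
  obtain e2 L2 where e2: "0 < e2" "L2-lipschitz_on (ball x0 e2 \<inter> I) v2"
    using lip2 I(1) unfolding locally_lipschitz_on_def by blast
  have cont_at: "isCont v x0" if "0 < e" "L-lipschitz_on (ball x0 e \<inter> I) v" for v :: "real \<Rightarrow> real" and e L
    using lipschitz_on_continuous_on[OF that(2)] that(1) I
    by (simp add: continuous_on_eq_continuous_at open_Int)
  have cont1: "isCont v1 x0" and cont2: "isCont v2 x0" using cont_at e1 e2 by blast+
  have ev: "\<forall>\<^sub>F y in nhds x0. y \<in> I \<and> dist y x0 < e1 \<and> dist y x0 < e2 \<and>
    v1 x0 / 2 < v1 y \<and> v2 y < v2 x0 + 1 \<and> c y < c x0 + 1"
  proof (intro eventually_conj)
    show "\<forall>\<^sub>F y in nhds x0. y \<in> I" using I by (intro eventually_nhds_in_open)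
    show "\<forall>\<^sub>F y in nhds x0. dist y x0 < e1" "\<forall>\<^sub>F y in nhds x0. dist y x0 < e2"
      using e1(1) e2(1) by (auto simp: eventually_nhds_metric)
    show "\<forall>\<^sub>F y in nhds x0. v1 x0 / 2 < v1 y"
      using cont1 pos unfolding isCont_def tendsto_at_iff_tendsto_nhds by (intro order_tendstoD(1)) auto
    show "\<forall>\<^sub>F y in nhds x0. v2 y < v2 x0 + 1"
      using cont2 unfolding isCont_def tendsto_at_iff_tendsto_nhds by (intro order_tendstoD(2)) auto
    show "\<forall>\<^sub>F y in nhds x0. c y < c x0 + 1"
      using contc unfolding isCont_def tendsto_at_iff_tendsto_nhds by (intro order_tendstoD(2)) auto
  qed
  then obtain \<epsilon> where \<epsilon>: "0 < \<epsilon>" "\<And>y. dist y x0 < \<epsilon> \<Longrightarrow> y \<in> I \<and> dist y x0 < e1 \<and> dist y x0 < e2 \<and>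
    v1 x0 / 2 < v1 y \<and> v2 y < v2 x0 + 1 \<and> c y < c x0 + 1"
    by (auto simp: eventually_nhds_metric)
  define J where "J = {x0 - \<epsilon><..<x0 + \<epsilon>}"
  have J: "y \<in> I \<and> dist y x0 < e1 \<and> dist y x0 < e2 \<and> v1 x0 / 2 < v1 y \<and> v2 y < v2 x0 + 1 \<and> c y < c x0 + 1"
    if "y \<in> J" for y
    using \<epsilon>(2)[of y] that by (simp add: J_def dist_real_def abs_less_iff)
  have x0J: "x0 \<in> J" using \<epsilon>(1) by (simp add: J_def)
  have JI: "J \<subseteq> I" using J by blast
  have lipJ1: "L1-lipschitz_on J v1" using e1(2) by (rule lipschitz_on_subset) (use J in \<open>auto simp: dist_commute\<close>)
  have lipJ2: "L2-lipschitz_on J v2" using e2(2) by (rule lipschitz_on_subset) (use J in \<open>auto simp: dist_commute\<close>)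
  have lipJ2': "L2-lipschitz_on J (\<lambda>y. - v2 y)" using lipJ2 by (rule lipschitz_on_minus)
  have oJ: "open J" by (simp add: J_def)
  \<comment> \<open>Adding a superjet of \<open>s\<close> to a superjet of \<open>g\<close> gives
    one of \<open>- v2\<close>, to which the supersolution inequality applies.\<close>
  define g where "g = (\<lambda>y. - v2 y - s y)"
  have jg: "superjet (\<lambda>y. - v2 y) x (d + s1 x) (p + c x)" if "x \<in> J" "superjet g x d p" for x d p
    by (rule superjet_cong[OF superjet_add[OF that(2) js]]) (use that JI in \<open>auto simp: g_def\<close>)
  \<comment> \<open>\<open>C1\<close> is the ellipticity bound for solutions of size at least
    \<open>v1 x0 / 2\<close>. \<open>C2\<close> solves the supersolution inequality at
    \<open>u = 1\<close>, where the diffusion does not degenerate, and allows for the curvature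
    \<open>c\<close> of the penalty.\<close>
  define C1 where "C1 = 2 * \<bar>\<mu>\<bar> * L1 / (\<sigma>\<^sup>2 * (q * (v1 x0 / 2) / (\<bar>\<mu>\<bar> * L1 + 1))\<^sup>2)"
  define C2 where "C2 = 2 * (\<bar>q\<bar> * \<bar>v2 x0 + 1\<bar> + \<bar>\<mu>\<bar> * L2) / \<sigma>\<^sup>2 + (c x0 + 1)"
  have p1: "- C1 \<le> p" if x: "x \<in> J" and j: "superjet v1 x d p" for x d p
  proof -
    obtain u where u: "u \<in> {0..1}" "q * v1 x \<le> 1/2 * \<sigma>\<^sup>2 * u\<^sup>2 * p + \<mu> * u * d"
      using sub[OF _ j] x JI by blast
    have "q * (v1 x0 / 2) \<le> q * v1 x" using J[OF x] q by (intro mult_left_mono) auto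
    then have "q * (v1 x0 / 2) \<le> 1/2 * \<sigma>\<^sup>2 * u\<^sup>2 * p + \<mu> * u * d" using u(2) by linarith
    with superjet_slope_le_lipschitz[OF j lipJ1 oJ x] u(1) show ?thesis
      unfolding C1_def using q pos \<sigma> by (intro curvature_lower_bound) auto
  qed
  have p2: "- C2 \<le> p" if x: "x \<in> J" and j: "superjet g x d p" for x d p
  proof -
    have "\<bar>d + s1 x\<bar> \<le> L2" by (rule superjet_slope_le_lipschitz[OF jg[OF x j] lipJ2' oJ x])
    then have "\<mu> * (d + s1 x) \<le> \<bar>\<mu>\<bar> * L2"
      by (rule mult_le_abs_mult)
    moreover have "- (1/2 * \<sigma>\<^sup>2 * 1\<^sup>2 * (p + c x) + \<mu> * 1 * (d + s1 x)) \<le> q * v2 x"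
      by (rule super[OF _ jg[OF x j]]) (use x JI in auto)
    then have "- (1/2 * ((p + c x) * \<sigma>\<^sup>2) + \<mu> * (d + s1 x)) \<le> q * v2 x" by (simp add: mult.commute)
    moreover have "q * v2 x \<le> \<bar>q\<bar> * \<bar>v2 x0 + 1\<bar>"
    proof -
      have "v2 x < v2 x0 + 1" using J[OF x] by blast
      then have "v2 x \<le> \<bar>v2 x0 + 1\<bar>" by linarith
      then show ?thesis using q by (simp add: mult_left_mono)
    qed
    ultimately have "- (2 * (\<bar>q\<bar> * \<bar>v2 x0 + 1\<bar> + \<bar>\<mu>\<bar> * L2)) \<le> (p + c x) * \<sigma>\<^sup>2" by argo
    then have "- (2 * (\<bar>q\<bar> * \<bar>v2 x0 + 1\<bar> + \<bar>\<mu>\<bar> * L2) / \<sigma>\<^sup>2) \<le> p + c x"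
      using \<sigma> by (simp only: minus_divide_left pos_divide_le_eq zero_less_power)
    moreover have "c x < c x0 + 1" using J[OF x] by blast
    ultimately show ?thesis unfolding C2_def by linarith
  qed
  have step: "\<exists>x x'. \<bar>x - x0\<bar> < \<eta> \<and> \<bar>x' - x0\<bar> < \<eta> \<and>
      q * v1 x - q * v2 x' \<le> \<bar>\<mu>\<bar> * (\<eta> + \<bar>s1 x'\<bar>) + 1/2 * \<sigma>\<^sup>2 * (\<eta> + \<bar>c x'\<bar>)" if \<eta>: "0 < \<eta>" for \<eta>
  proof -
    have contg: "continuous_on J g"
      unfolding g_def
      by (intro continuous_intros lipschitz_on_continuous_on[OF lipJ2] continuous_on_subset[OF conts JI])
    have p1': "- max C1 C2 \<le> p" if "x \<in> J" "superjet v1 x d p" for x d p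
      using p1[OF that] by simp
    have p2': "- max C1 C2 \<le> p" if "x \<in> J" "superjet g x d p" for x d p
      using p2[OF that] by simp
    have mx': "v1 y + g y \<le> v1 x0 + g x0" if "y \<in> J" for y
      using mx[OF subsetD[OF JI that]] by (simp add: g_def)
    obtain x d p x' d' p' where xs: "x \<in> J" "x' \<in> J" "\<bar>x - x0\<bar> < \<eta>" "\<bar>x' - x0\<bar> < \<eta>"
      and js': "superjet v1 x d p" "superjet g x' d' p'" and dp: "\<bar>d + d'\<bar> \<le> \<eta>" "p + p' \<le> \<eta>"
      by (rule theorem_on_sums[of "x0 - \<epsilon>" "x0 + \<epsilon>", folded J_def,
            OF lipschitz_on_continuous_on[OF lipJ1] contg p1' p2' x0J mx' \<eta>])
    obtain u where u: "u \<in> {0..1}" "q * v1 x \<le> 1/2 * \<sigma>\<^sup>2 * u\<^sup>2 * p + \<mu> * u * d"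
      using sub[OF _ js'(1)] xs JI by blast
    have "- (1/2 * \<sigma>\<^sup>2 * u\<^sup>2 * (p' + c x') + \<mu> * u * (d' + s1 x')) \<le> q * v2 x'"
      by (rule super[OF _ jg[OF xs(2) js'(2)] u(1)]) (use xs JI in blast)
    then have "q * v1 x - q * v2 x' \<le> 1/2 * \<sigma>\<^sup>2 * u\<^sup>2 * (p + p' + c x') + \<mu> * u * (d + d' + s1 x')"
      using u(2) by (simp add: algebra_simps add_divide_distrib)
    \<comment> \<open>The one-sided bound on \<open>p + p'\<close> suffices because its factor is
      nonnegative; with \<open>\<bar>c x'\<bar>\<close> the bound is nonnegative too, so
      \<open>u\<^sup>2\<close> can be replaced by 1.\<close>
    moreover have "1/2 * \<sigma>\<^sup>2 * u\<^sup>2 * (p + p' + c x') \<le> 1/2 * \<sigma>\<^sup>2 * (\<eta> + \<bar>c x'\<bar>)"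
    proof -
      have "u\<^sup>2 \<le> 1\<^sup>2" using u(1) by (intro power_mono) auto
      then have "u\<^sup>2 * (\<eta> + \<bar>c x'\<bar>) \<le> 1 * (\<eta> + \<bar>c x'\<bar>)"
        using \<eta> by (intro mult_right_mono) auto
      moreover have "u\<^sup>2 * (p + p' + c x') \<le> u\<^sup>2 * (\<eta> + \<bar>c x'\<bar>)"
        using dp(2) by (intro mult_left_mono) auto
      ultimately have "u\<^sup>2 * (p + p' + c x') \<le> 1 * (\<eta> + \<bar>c x'\<bar>)" by linarith
      then have "1/2 * \<sigma>\<^sup>2 * (u\<^sup>2 * (p + p' + c x')) \<le> 1/2 * \<sigma>\<^sup>2 * (1 * (\<eta> + \<bar>c x'\<bar>))"
        by (intro mult_left_mono) auto
      then show ?thesis by (simp only: mult.assoc mult_1_left)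
    qed
    moreover have "\<mu> * u * (d + d' + s1 x') \<le> \<bar>\<mu>\<bar> * (\<eta> + \<bar>s1 x'\<bar>)"
    proof -
      have "\<bar>u\<bar> * \<bar>d + d' + s1 x'\<bar> \<le> 1 * (\<eta> + \<bar>s1 x'\<bar>)"
        using u(1) dp(1) \<eta> by (intro mult_mono) auto
      then have "\<mu> * (u * (d + d' + s1 x')) \<le> \<bar>\<mu>\<bar> * (\<eta> + \<bar>s1 x'\<bar>)"
        by (intro mult_le_abs_mult) (simp add: abs_mult)
      then show ?thesis by (simp only: mult.assoc)
    qed
    ultimately show ?thesis using xs by (intro exI[of _ x] exI[of _ x']) auto
  qed
  \<comment> \<open>The two superjets sit at different points, so the estimate at \<open>x0\<close>
    is obtained by letting \<open>\<eta>\<close> tend to 0 along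
    \<open>1 / (real n + 1)\<close>.\<close>
  have "\<forall>n. \<exists>x x'. \<bar>x - x0\<bar> < 1 / (real n + 1) \<and> \<bar>x' - x0\<bar> < 1 / (real n + 1) \<and>
      q * v1 x - q * v2 x' \<le> \<bar>\<mu>\<bar> * (1 / (real n + 1) + \<bar>s1 x'\<bar>) + 1/2 * \<sigma>\<^sup>2 * (1 / (real n + 1) + \<bar>c x'\<bar>)"
    by (intro allI step) simp
  then obtain X X' where X: "\<And>n. \<bar>X n - x0\<bar> < 1 / (real n + 1)" "\<And>n. \<bar>X' n - x0\<bar> < 1 / (real n + 1)"
      "\<And>n. q * v1 (X n) - q * v2 (X' n)
        \<le> \<bar>\<mu>\<bar> * (1 / (real n + 1) + \<bar>s1 (X' n)\<bar>) + 1/2 * \<sigma>\<^sup>2 * (1 / (real n + 1) + \<bar>c (X' n)\<bar>)"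
    by metis
  have lim: "X \<longlonglongrightarrow> x0" "X' \<longlonglongrightarrow> x0" using LIMSEQ_if_dist_less_inverse X by blast+
  have lim0: "(\<lambda>n. 1 / (real n + 1)) \<longlonglongrightarrow> 0"
    using LIMSEQ_inverse_real_of_nat by (simp add: inverse_eq_divide add.commute)
  have "q * v1 x0 - q * v2 x0 \<le> \<bar>\<mu>\<bar> * (0 + \<bar>s1 x0\<bar>) + 1/2 * \<sigma>\<^sup>2 * (0 + \<bar>c x0\<bar>)"
  proof (rule LIMSEQ_le)
    show "(\<lambda>n. q * v1 (X n) - q * v2 (X' n)) \<longlonglongrightarrow> q * v1 x0 - q * v2 x0"
      by (intro tendsto_intros isCont_tendsto_compose[OF cont1] isCont_tendsto_compose[OF cont2] lim)
    show "(\<lambda>n. \<bar>\<mu>\<bar> * (1 / (real n + 1) + \<bar>s1 (X' n)\<bar>) + 1/2 * \<sigma>\<^sup>2 * (1 / (real n + 1) + \<bar>c (X' n)\<bar>))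
      \<longlonglongrightarrow> \<bar>\<mu>\<bar> * (0 + \<bar>s1 x0\<bar>) + 1/2 * \<sigma>\<^sup>2 * (0 + \<bar>c x0\<bar>)"
      by (intro tendsto_add tendsto_mult tendsto_const lim0 tendsto_rabs
          isCont_tendsto_compose[OF conts1] isCont_tendsto_compose[OF contc] lim)
  qed (use X(3) in blast)
  then show ?thesis by (simp add: algebra_simps)
qed

section \<open>Penalization and barrier\<close>

lemma polynomial_growth_less_exp:
  assumes "polynomial_growth w" "0 < \<epsilon>" "0 < k"
  shows "\<forall>\<^sub>F x in at_top. w x < \<epsilon> * exp (k * x)"
proof -
  obtain C n where C: "\<And>x. 0 \<le> x \<Longrightarrow> \<bar>w x\<bar> \<le> C * (1 + x ^ n)"
    using assms(1) unfolding polynomial_growth_def by blast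
  have kx: "filterlim (\<lambda>x. k * x) at_top at_top"
    using assms(3) by (intro filterlim_tendsto_pos_mult_at_top[OF tendsto_const _ filterlim_ident])
  have pow: "((\<lambda>x. (k * x) ^ j / exp (k * x)) \<longlongrightarrow> 0) at_top" for j
    by (rule filterlim_compose[OF tendsto_power_div_exp_0 kx])
  have "((\<lambda>x. C * ((k * x) ^ 0 / exp (k * x)) + C / k ^ n * ((k * x) ^ n / exp (k * x))) \<longlongrightarrow> C * 0 + C / k ^ n * 0) at_top"
    by (intro tendsto_intros pow)
  then have "\<forall>\<^sub>F x in at_top. C * ((k * x) ^ 0 / exp (k * x)) + C / k ^ n * ((k * x) ^ n / exp (k * x)) < \<epsilon>"
    using assms(2) by (intro order_tendstoD(2)) auto
  then show ?thesis using eventually_ge_at_top[of 0]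
  proof eventually_elim
    case (elim x)
    have "C * ((k * x) ^ 0 / exp (k * x)) + C / k ^ n * ((k * x) ^ n / exp (k * x)) = C * (1 + x ^ n) / exp (k * x)"
      using assms(3) by (simp add: power_mult_distrib field_simps)
    with elim(1) have "C * (1 + x ^ n) < \<epsilon> * exp (k * x)" by (simp add: pos_divide_less_eq)
    then show ?case using C[OF elim(2)] by linarith
  qed
qed

lemma exp_le_quadratic:
  fixes t :: real
  assumes "\<bar>t\<bar> \<le> 1"
  shows "exp t \<le> 1 + t + t\<^sup>2"
proof (cases "0 \<le> t")
  case True then show ?thesis using assms exp_bound[of t] by simp
next
  case False
  \<comment> \<open>The product equals \<open>1 - t ^ 3\<close>; afterwards \<open>1 - t\<close> is
    replaced by the larger \<open>exp (- t)\<close>.\<close>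
  have "1 \<le> (1 + t + t\<^sup>2) * (1 - t)"
  proof -
    have "(1 + t + t\<^sup>2) * (1 - t) = 1 + (- t) * t\<^sup>2" by (simp add: power2_eq_square algebra_simps)
    moreover have "0 \<le> (- t) * t\<^sup>2" using False by (intro mult_nonneg_nonneg) auto
    ultimately show ?thesis by linarith
  qed
  moreover have "1 - t \<le> exp (- t)" using exp_ge_add_one_self[of "- t"] by simp
  moreover have "0 \<le> 1 + t + t\<^sup>2" using assms by (simp add: add_nonneg_nonneg)
  ultimately have "1 \<le> (1 + t + t\<^sup>2) * exp (- t)"
    using mult_left_mono[of "1 - t" "exp (- t)" "1 + t + t\<^sup>2"] by linarith
  then have "1 * exp t \<le> (1 + t + t\<^sup>2) * exp (- t) * exp t" by (intro mult_right_mono) auto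
  then show ?thesis by (simp add: mult.assoc flip: exp_add)
qed

text \<open>The second-order part is twice the true second derivative: superjets carry no remainder
  here, and the factor 2 absorbs the Taylor error.\<close>

lemma superjet_exp: "superjet (\<lambda>y. exp (k * y)) x (k * exp (k * x)) (2 * k\<^sup>2 * exp (k * x))"
  unfolding superjet_def
proof -
  have "((\<lambda>y. \<bar>k * (y - x)\<bar>) \<longlongrightarrow> \<bar>k * (x - x)\<bar>) (nhds x)"
    by (intro tendsto_intros filterlim_ident)
  then have "\<forall>\<^sub>F y in nhds x. \<bar>k * (y - x)\<bar> < 1" by (rule order_tendstoD(2)) simp
  then show "\<forall>\<^sub>F y in nhds x. exp (k * y) \<le> exp (k * x) + k * exp (k * x) * (y - x) + 2 * k\<^sup>2 * exp (k * x) / 2 * (y - x)\<^sup>2"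
  proof eventually_elim
    case (elim y)
    have "exp (k * y) = exp (k * x) * exp (k * (y - x))" by (simp add: algebra_simps flip: exp_add)
    also have "\<dots> \<le> exp (k * x) * (1 + k * (y - x) + (k * (y - x))\<^sup>2)"
      using elim by (intro mult_left_mono exp_le_quadratic) auto
    also have "\<dots> = exp (k * x) + k * exp (k * x) * (y - x) + 2 * k\<^sup>2 * exp (k * x) / 2 * (y - x)\<^sup>2"
      by (simp add: power2_eq_square algebra_simps)
    finally show ?case .
  qed
qed

lemma superjet_quadratic: "superjet (\<lambda>y. K * (y - a)\<^sup>2 + b * (y - a)) x (2 * K * (x - a) + b) (2 * K)"
  by (simp add: superjet_def power2_eq_square algebra_simps)

lemma continuous_attains_max_on_halfline:
  fixes W :: "real \<Rightarrow> real"
  assumes cont: "continuous_on {0..} W" and neg: "\<forall>\<^sub>F x in at_top. W x < 0"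
    and pos: "0 \<le> x'" "0 < W x'"
  obtains x0 where "0 \<le> x0" "\<And>y. 0 \<le> y \<Longrightarrow> W y \<le> W x0"
proof -
  obtain R where R: "\<And>x. R \<le> x \<Longrightarrow> W x < 0" using neg by (auto simp: eventually_at_top_linorder)
  obtain x0 where x0: "x0 \<in> {0..max R x'}" "\<And>y. y \<in> {0..max R x'} \<Longrightarrow> W y \<le> W x0"
    using continuous_attains_sup[of "{0..max R x'}" W] continuous_on_subset[OF cont, of "{0..max R x'}"] pos(1)
    by (auto simp: le_max_iff_disj)
  show thesis
  proof
    show "0 \<le> x0" using x0(1) by simp
    fix y :: real assume y: "0 \<le> y"
    show "W y \<le> W x0"
    proof (cases "y \<le> max R x'")
      case True then show ?thesis using x0(2) y by simp
    next
      case False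
      then have "W y < 0" using R[of y] by simp
      also have "0 < W x0" using x0(2)[of x'] pos by simp
      finally show ?thesis by simp
    qed
  qed
qed

text \<open>An admissible jump of \<open>v1\<close> near \<open>x0\<close> must be long, by continuity, and \<open>v1 - v2\<close> does not
  decrease along it while \<open>s\<close> drops by a definite amount, so \<open>v1 - v2 - s\<close> would exceed its maximum.\<close>
lemma no_jump_near_max:
  fixes v1 v2 s :: "real \<Rightarrow> real"
  assumes \<beta>: "0 < \<beta>" and x0: "0 < x0"
    and cont: "isCont v1 x0" "isCont v2 x0" "isCont s x0" and s: "strict_mono s"
    and mx: "\<And>y. 0 \<le> y \<Longrightarrow> v1 y - v2 y - s y \<le> v1 x0 - v2 x0 - s x0"
    and jump: "\<And>x z. 0 \<le> z \<Longrightarrow> z \<le> x \<Longrightarrow> v2 z + x - z - \<beta> \<le> v2 x"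
  obtains \<delta> where "0 < \<delta>" "\<And>x z. \<bar>x - x0\<bar> < \<delta> \<Longrightarrow> z \<in> {0..x} \<Longrightarrow> v1 z + x - z - \<beta> < v1 x"
proof -
  obtain e where e: "0 < e" "\<And>y. \<bar>y - x0\<bar> < e \<Longrightarrow> \<bar>v1 y - v1 x0\<bar> < \<beta> / 4"
    using cont(1) \<beta> unfolding continuous_at_eps_delta dist_real_def by (metis zero_less_divide_iff zero_less_numeral)
  define d where "d = min e (\<beta> / 4)"
  have d: "0 < d" "d \<le> e" "d \<le> \<beta> / 4" using e(1) \<beta> by (auto simp: d_def)
  \<comment> \<open>Any jump from within \<open>d / 2\<close> of \<open>x0\<close> to a point at or
    below \<open>x0 - d\<close> makes \<open>s\<close> drop by at least this amount.\<close>
  define \<gamma> where "\<gamma> = s (x0 - d / 2) - s (x0 - d)"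
  have \<gamma>: "0 < \<gamma>" using d strict_monoD[OF s, of "x0 - d" "x0 - d / 2"] by (simp add: \<gamma>_def)
  have "isCont (\<lambda>y. v1 y - v2 y - s y) x0" using cont by (intro continuous_intros)
  then obtain e' where e': "0 < e'"
    "\<And>y. \<bar>y - x0\<bar> < e' \<Longrightarrow> \<bar>(v1 y - v2 y - s y) - (v1 x0 - v2 x0 - s x0)\<bar> < \<gamma>"
    using \<gamma> unfolding continuous_at_eps_delta dist_real_def by metis
  show thesis
  proof
    show "0 < min (d / 2) e'" using d e' by simp
    fix x z assume x: "\<bar>x - x0\<bar> < min (d / 2) e'" and z: "z \<in> {0..x}"
    show "v1 z + x - z - \<beta> < v1 x"
    proof (cases "x0 - d < z")
      case True
      \<comment> \<open>A short jump gains less than \<open>\<beta> / 2\<close> by its length and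
        less than \<open>\<beta> / 2\<close> by the variation of \<open>v1\<close>, together less
        than its cost \<open>\<beta>\<close>.\<close>
      have "\<bar>x - x0\<bar> < d / 2" using x by simp
      then have x': "x - x0 < d / 2" "x0 - x < d / 2" by linarith+
      have "\<bar>z - x0\<bar> < e" "\<bar>x - x0\<bar> < e" using x' z True d unfolding abs_less_iff by auto
      then have "\<bar>v1 z - v1 x0\<bar> < \<beta> / 4" "\<bar>v1 x - v1 x0\<bar> < \<beta> / 4" by (auto intro!: e(2) simp del: less_divide_eq_numeral1)
      moreover have "x - z < 2 * d" using x' True d by linarith
      ultimately show ?thesis using d(3) by linarith
    next
      case False
      show ?thesis
      proof (rule ccontr)
        assume "\<not> ?thesis"
        then have "v1 x - v2 x \<le> v1 z - v2 z" using jump[of z x] z by simp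
        moreover have "\<bar>x - x0\<bar> < d / 2" using x by simp
        then have "x0 - d / 2 \<le> x" by linarith
        then have "s z \<le> s (x0 - d)" "s (x0 - d / 2) \<le> s x"
          using False strict_mono_less_eq[OF s] by auto
        moreover have "v1 x0 - v2 x0 - s x0 - \<gamma> < v1 x - v2 x - s x" using e'(2)[of x] x by simp
        moreover have "v1 z - v2 z - s z \<le> v1 x0 - v2 x0 - s x0" using mx z by simp
        ultimately show False unfolding \<gamma>_def by linarith
      qed
    qed
  qed
qed

text \<open>The barrier of Hopf's lemma: it vanishes at \<open>a\<close> with positive slope, so subtracting it from
  a function with a critical maximum at \<open>a\<close> moves the maximum into the interior.\<close>
lemma hopf_barrier:
  fixes W :: "real \<Rightarrow> real"
  assumes deriv: "(W has_real_derivative 0) (at a)" and mx: "\<And>y. y \<in> {a - \<delta>..a} \<Longrightarrow> W y \<le> W a"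
    and cont: "continuous_on {a - \<delta>..a} W" and \<delta>: "0 < \<delta>" and K: "0 < K"
  defines "b \<equiv> \<lambda>y. K * (y - a)\<^sup>2 + K * \<delta> / 2 * (y - a)"
  obtains x where "x \<in> {a - \<delta><..<a}" "\<And>y. y \<in> {a - \<delta>..a} \<Longrightarrow> W y - b y \<le> W x - b x" "W a \<le> W x - b x"
proof -
  have "continuous_on {a - \<delta>..a} (\<lambda>y. W y - b y)" unfolding b_def by (intro continuous_intros cont)
  then obtain x where x: "x \<in> {a - \<delta>..a}" "\<And>y. y \<in> {a - \<delta>..a} \<Longrightarrow> W y - b y \<le> W x - b x"
    using continuous_attains_sup[of "{a - \<delta>..a}" "\<lambda>y. W y - b y"] \<delta> by auto
  have ba: "b a = 0" by (simp add: b_def)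
  have above: "\<exists>y\<in>{a - \<delta>..a}. W a < W y - b y"
  proof -
    have "((\<lambda>h. (W (a + h) - W a) / h) \<longlongrightarrow> 0) (at 0)" using deriv by (simp add: DERIV_def)
    from tendstoD[OF this, of "K * \<delta> / 4"] K \<delta>
    obtain e where e: "0 < e" "\<And>h. h \<noteq> 0 \<Longrightarrow> \<bar>h\<bar> < e \<Longrightarrow> \<bar>(W (a + h) - W a) / h\<bar> < K * \<delta> / 4"
      by (auto simp: eventually_at dist_real_def)
    \<comment> \<open>Over a step \<open>t\<close> to the left, \<open>W\<close> loses less than a
      quarter of \<open>K * \<delta> * t\<close>, while \<open>- b\<close> gains half of it minus
      \<open>K * t * t\<close>; \<open>t \<le> \<delta> / 4\<close> limits that last term to another
      quarter.\<close>
    define t where "t = min (e / 2) (\<delta> / 4)"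
    have "0 < t" using e(1) \<delta> by (simp add: t_def)
    moreover have "t \<le> e / 2" "t \<le> \<delta> / 4" by (auto simp: t_def)
    ultimately have t: "0 < t" "t < e" "t \<le> \<delta> / 4" using e(1) by linarith+
    have "\<bar>(W (a + - t) - W a) / - t\<bar> < K * \<delta> / 4" by (rule e(2)) (use t in auto)
    then have "\<bar>W (a - t) - W a\<bar> < K * \<delta> / 4 * t" using t(1) by (simp add: abs_divide pos_divide_less_eq)
    then have "W a - K * \<delta> / 4 * t < W (a - t)" by linarith
    moreover have "K * t * t \<le> K * t * (\<delta> / 4)" using t K by (intro mult_left_mono) auto
    moreover have "b (a - t) = K * t * t - K * \<delta> / 2 * t" by (simp add: b_def power2_eq_square)
    ultimately have "W a < W (a - t) - b (a - t)" by (simp add: algebra_simps)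
    then show ?thesis using t by (intro bexI[of _ "a - t"]) auto
  qed
  then have gt: "W a < W x - b x" using x(2) by force
  \<comment> \<open>Since \<open>b y\<close> factors as
    \<open>K * (y - a) * (y - a + \<delta> / 2)\<close>, it is positive at the left endpoint, which
    therefore cannot carry the maximum.\<close>
  have "b (a - \<delta>) = K * \<delta>\<^sup>2 / 2" by (simp add: b_def power2_eq_square field_simps)
  moreover have "0 < K * \<delta>\<^sup>2" using K \<delta> by simp
  ultimately have "0 < b (a - \<delta>)" by linarith
  then have "x \<noteq> a - \<delta>" using gt mx[of "a - \<delta>"] \<delta> by auto
  moreover have "x \<noteq> a" using gt ba by auto
  ultimately show thesis using that[of x] x gt by auto
qed

section \<open>Comparison\<close>

lemma locally_lipschitz_on_subset:
  assumes "locally_lipschitz_on S f" "T \<subseteq> S"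
  shows "locally_lipschitz_on T f"
  unfolding locally_lipschitz_on_def
proof
  fix x assume "x \<in> T"
  then obtain e C where "0 < e" "C-lipschitz_on (ball x e \<inter> S) f"
    using assms unfolding locally_lipschitz_on_def by blast
  moreover from this(2) have "C-lipschitz_on (ball x e \<inter> T) f"
    by (rule lipschitz_on_subset) (use assms(2) in blast)
  ultimately show "\<exists>e>0. \<exists>C. C-lipschitz_on (ball x e \<inter> T) f" by blast
qed

theorem theorem2p7:
  fixes a \<mu>p \<mu>m \<sigma>p \<sigma>m q \<beta> :: real and v1 v2 :: "real \<Rightarrow> real"
  assumes "a > 0" and "\<sigma>p > 0" and "\<sigma>m > 0" and "q > 0" and "\<beta> > 0"
    and "\<forall>x\<ge>0. 0 \<le> v1 x" and "viscosity_subsolution a \<mu>p \<mu>m \<sigma>p \<sigma>m q \<beta> v1"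
    and "\<forall>x\<ge>0. 0 \<le> v2 x" and "viscosity_supersolution a \<mu>p \<mu>m \<sigma>p \<sigma>m q \<beta> v2"
    and "v1 \<in> class_A" and "v2 \<in> class_A"
    and "(SUP x\<in>{0..}. ereal (v1 x - v2 x)) > ereal (v1 a - v2 a)
         \<or> (\<lambda>x. v1 x - v2 x) differentiable (at a)"
  shows "\<forall>x\<ge>0. v1 x \<le> v2 x"
proof (rule ccontr)
  note pos = assms(1-5) and sub = assms(7) and super = assms(9)
  have nn2: "0 \<le> v2 x" if "0 \<le> x" for x using assms(8) that by blast
  have cont: "continuous_on {0..} v1" "continuous_on {0..} v2"
    and pg: "polynomial_growth v1" "polynomial_growth v2"
    and lip: "locally_lipschitz_on {0<..} v1" "locally_lipschitz_on {0<..} v2"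
    and zero: "v1 0 = 0" "v2 0 = 0"
    using assms(10,11) by (auto simp: class_A_def)
  have isCont: "isCont v1 x" "isCont v2 x" if "0 < x" for x
    using that by (auto intro: continuous_on_interior[OF cont(1)] continuous_on_interior[OF cont(2)])
  have jump: "v2 z + x - z - \<beta> \<le> v2 x" if "0 \<le> z" "z \<le> x" for x z
    using supersolution_jump[OF super pg(2) nn2 _ that] pos by simp

  \<comment> \<open>\<open>B\<close> bounds drift plus squared volatility in both regimes. With
    \<open>k\<close> this small, the drift and diffusion terms of the exponential cost at most half
    of the discount \<open>q\<close>; \<open>k \<le> 1\<close> reduces \<open>k\<^sup>2\<close> to
    \<open>k\<close>.\<close>
  define B where "B = \<sigma>p\<^sup>2 + \<sigma>m\<^sup>2 + \<bar>\<mu>p\<bar> + \<bar>\<mu>m\<bar>"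
  define k where "k = min 1 (q / (2 * (B + 1)))"
  have B: "0 \<le> B" by (simp add: B_def)
  have k: "0 < k" "k \<le> 1" "k \<le> q / (2 * (B + 1))" using pos B by (auto simp: k_def)
  have kB: "k * B \<le> q / 2"
  proof -
    have "k * (2 * (B + 1)) \<le> q" using k(3) B by (subst (asm) pos_le_divide_eq) auto
    then show ?thesis using k(1) by (simp add: algebra_simps)
  qed
  have generator: "\<bar>\<mu>\<bar> * k + \<sigma>\<^sup>2 * k\<^sup>2 \<le> q / 2" if "\<bar>\<mu>\<bar> + \<sigma>\<^sup>2 \<le> B" for \<mu> \<sigma>
  proof -
    have "k\<^sup>2 \<le> k" using k by (simp add: power2_eq_square mult_left_le)
    then have "\<sigma>\<^sup>2 * k\<^sup>2 \<le> \<sigma>\<^sup>2 * k" by (rule mult_left_mono) simp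
    moreover have "k * (\<bar>\<mu>\<bar> + \<sigma>\<^sup>2) \<le> k * B" using that k by (intro mult_left_mono) auto
    ultimately show ?thesis using kB by (simp add: algebra_simps)
  qed

  assume "\<not> ?thesis"
  then obtain x' where x': "0 \<le> x'" "0 < v1 x' - v2 x'" by force
  \<comment> \<open>The penalty must leave \<open>W\<close> positive at \<open>x'\<close>. Where
    differentiability at \<open>a\<close> is missing, it must also be too small to make
    \<open>a\<close> a maximum point of \<open>W\<close>.\<close>
  obtain \<epsilon> where \<epsilon>: "0 < \<epsilon>" "\<epsilon> * exp (k * x') < v1 x' - v2 x'"
    "(\<exists>y\<ge>0. v1 a - v2 a - \<epsilon> * exp (k * a) < v1 y - v2 y - \<epsilon> * exp (k * y))
      \<or> (\<lambda>x. v1 x - v2 x) differentiable (at a)"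
  proof (cases "(\<lambda>x. v1 x - v2 x) differentiable (at a)")
    case True
    then show thesis using that[of "(v1 x' - v2 x') / (2 * exp (k * x'))"] x' by simp
  next
    case False
    then obtain y where y: "0 \<le> y" "v1 a - v2 a < v1 y - v2 y"
      using assms(12) by (auto simp: less_SUP_iff)
    define \<epsilon> where "\<epsilon> = min ((v1 x' - v2 x') / (2 * exp (k * x'))) ((v1 y - v2 y - (v1 a - v2 a)) / (2 * exp (k * y)))"
    have e0: "0 < \<epsilon>" using x' y by (simp add: \<epsilon>_def)
    have "\<epsilon> \<le> (v1 x' - v2 x') / (2 * exp (k * x'))" by (simp add: \<epsilon>_def)
    then have "\<epsilon> * (2 * exp (k * x')) \<le> v1 x' - v2 x'" by (simp add: pos_le_divide_eq)
    then have e1: "\<epsilon> * exp (k * x') < v1 x' - v2 x'" using x' by simp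
    have "\<epsilon> \<le> (v1 y - v2 y - (v1 a - v2 a)) / (2 * exp (k * y))" unfolding \<epsilon>_def by (rule min.cobounded2)
    then have "\<epsilon> * (2 * exp (k * y)) \<le> v1 y - v2 y - (v1 a - v2 a)" by (subst (asm) pos_le_divide_eq) auto
    moreover have "0 < \<epsilon> * exp (k * a)" using e0 by simp
    ultimately have "v1 a - v2 a - \<epsilon> * exp (k * a) < v1 y - v2 y - \<epsilon> * exp (k * y)" using y by linarith
    then show thesis using that[OF e0 e1] y(1) by blast
  qed

  define W where "W = (\<lambda>y. v1 y - v2 y - \<epsilon> * exp (k * y))"
  have contW: "continuous_on {0..} W" unfolding W_def by (intro continuous_intros cont)
  have "\<forall>\<^sub>F x in at_top. W x < 0"
    using polynomial_growth_less_exp[OF pg(1) \<epsilon>(1) k(1)] eventually_ge_at_top[of 0]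
    by eventually_elim (use nn2 in \<open>fastforce simp: W_def\<close>)
  moreover have Wx': "0 < W x'" using \<epsilon>(2) by (simp add: W_def)
  ultimately obtain x0 where x0: "0 \<le> x0" "\<And>y. 0 \<le> y \<Longrightarrow> W y \<le> W x0"
    using continuous_attains_max_on_halfline[OF contW _ x'(1)] by blast
  have Wx0: "0 < W x0" using Wx' x0(2)[OF x'(1)] by simp
  \<comment> \<open>The boundary values exclude a maximum at 0, where the equation is not
    tested.\<close>
  have "W 0 < 0" using zero \<epsilon>(1) by (simp add: W_def)
  then have "0 < x0" using x0(1) Wx0 by (cases "x0 = 0") auto
  have mono: "strict_mono (\<lambda>y. \<epsilon> * exp (k * y))" using \<epsilon>(1) k(1) by (simp add: strict_mono_def)
  have contS: "isCont (\<lambda>y. \<epsilon> * exp (k * y)) x0" by (intro continuous_intros)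
  obtain \<delta> where \<delta>: "0 < \<delta>"
    "\<And>x z. \<bar>x - x0\<bar> < \<delta> \<Longrightarrow> z \<in> {0..x} \<Longrightarrow> v1 z + x - z - \<beta> < v1 x"
    by (rule no_jump_near_max[OF pos(5) \<open>0 < x0\<close> isCont[OF \<open>0 < x0\<close>] contS mono
          x0(2)[unfolded W_def] jump]) blast+

  \<comment> \<open>One estimate for both cases: \<open>R\<close> records on which side of
    \<open>a\<close> the set \<open>I\<close> lies. The quadratic is zero when
    \<open>x0 \<noteq> a\<close> and is Hopf's barrier when \<open>x0 = a\<close>.\<close>
  have local_bound: "q * (v1 x1 - v2 x1) \<le> \<bar>\<mu>\<bar> * \<bar>\<epsilon> * (k * exp (k * x1)) + (2 * K * (x1 - a) + b)\<bar>
      + 1/2 * \<sigma>\<^sup>2 * \<bar>\<epsilon> * (2 * k\<^sup>2 * exp (k * x1)) + 2 * K\<bar>"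
    if I: "open I" "x1 \<in> I" "I \<subseteq> {0<..}" "\<And>x. x \<in> I \<Longrightarrow> \<bar>x - x0\<bar> < \<delta> \<and> x \<noteq> a \<and> (a < x \<longleftrightarrow> R)"
      and par: "\<sigma> = (if R then \<sigma>p else \<sigma>m)" "\<mu> = (if R then \<mu>p else \<mu>m)"
      and mx: "\<And>y. y \<in> I \<Longrightarrow> W y - (K * (y - a)\<^sup>2 + b * (y - a)) \<le> W x1 - (K * (x1 - a)\<^sup>2 + b * (x1 - a))"
      and v1: "0 < v1 x1" for I x1 R \<sigma> \<mu> K b
  proof (rule max_principle[where s = "\<lambda>y. \<epsilon> * exp (k * y) + (K * (y - a)\<^sup>2 + b * (y - a))"
        and ?s1.0 = "\<lambda>x. \<epsilon> * (k * exp (k * x)) + (2 * K * (x - a) + b)"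
        and c = "\<lambda>x. \<epsilon> * (2 * k\<^sup>2 * exp (k * x)) + 2 * K" and I = I])
    show "0 < q" "0 < \<sigma>" using pos par by auto
    show "locally_lipschitz_on I v1" "locally_lipschitz_on I v2"
      using lip I(3) locally_lipschitz_on_subset by blast+
    show "\<exists>u\<in>{0..1}. q * v1 x \<le> 1/2 * \<sigma>\<^sup>2 * u\<^sup>2 * p + \<mu> * u * d" if xI: "x \<in> I" and jet: "superjet v1 x d p" for x d p
    proof -
      have "0 < x" "a < x \<longleftrightarrow> R" using I xI by auto
      have nj: "v1 z + x - z - \<beta> < v1 x" if "z \<in> {0..x}" for z
        using \<delta>(2)[OF _ that] I(4)[OF xI] by blast
      obtain u where "u \<in> {0..1}"
        "q * v1 x \<le> 1/2 * (if x > a then \<sigma>p else \<sigma>m)\<^sup>2 * u\<^sup>2 * p + (if x > a then \<mu>p else \<mu>m) * u * d"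
        by (rule subsolution_superjet[OF sub pg(1) \<open>0 < x\<close> nj jet])
      with \<open>a < x \<longleftrightarrow> R\<close> show ?thesis unfolding par by auto
    qed
    show "- (1/2 * \<sigma>\<^sup>2 * u\<^sup>2 * p + \<mu> * u * d) \<le> q * v2 x"
      if "x \<in> I" "superjet (\<lambda>y. - v2 y) x d p" "u \<in> {0..1}" for x d p u
    proof -
      have "0 < x" "x \<noteq> a" "a < x \<longleftrightarrow> R" using I that by auto
      then show ?thesis
        using supersolution_superjet(1)[OF super pg(2) _ _ that(2,3)] unfolding par by auto
    qed
    show "superjet (\<lambda>y. \<epsilon> * exp (k * y) + (K * (y - a)\<^sup>2 + b * (y - a))) x
        (\<epsilon> * (k * exp (k * x)) + (2 * K * (x - a) + b)) (\<epsilon> * (2 * k\<^sup>2 * exp (k * x)) + 2 * K)" for x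
      using \<epsilon>(1) by (intro superjet_add superjet_cmult superjet_exp superjet_quadratic) simp
    show "v1 y - v2 y - (\<epsilon> * exp (k * y) + (K * (y - a)\<^sup>2 + b * (y - a)))
        \<le> v1 x1 - v2 x1 - (\<epsilon> * exp (k * x1) + (K * (x1 - a)\<^sup>2 + b * (x1 - a)))" if "y \<in> I" for y
      using mx[OF that] by (simp add: W_def)
  qed (use I v1 in \<open>auto intro!: continuous_intros\<close>)

  show False
  proof (cases "x0 = a")
    case False
    define d where "d = min \<delta> (min x0 \<bar>x0 - a\<bar>)"
    have d: "0 < d" using \<delta>(1) \<open>0 < x0\<close> False by (simp add: d_def)
    define \<sigma> where "\<sigma> = (if a < x0 then \<sigma>p else \<sigma>m)"
    define \<mu> where "\<mu> = (if a < x0 then \<mu>p else \<mu>m)"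
    have "0 < \<epsilon> * exp (k * x0)" using \<epsilon>(1) by simp
    then have v12: "\<epsilon> * exp (k * x0) < v1 x0 - v2 x0" "0 < v1 x0"
      using Wx0 nn2[of x0] x0(1) unfolding W_def by linarith+
    have near: "0 < x \<and> \<bar>x - x0\<bar> < \<delta> \<and> x \<noteq> a \<and> (a < x \<longleftrightarrow> a < x0)" if "x \<in> {x0 - d<..<x0 + d}" for x
    proof -
      have "d \<le> \<delta>" "d \<le> x0" "d \<le> \<bar>x0 - a\<bar>" by (auto simp: d_def)
      moreover have "\<bar>x - x0\<bar> < d" using that by (simp add: abs_less_iff)
      ultimately show ?thesis by linarith
    qed
    have "q * (v1 x0 - v2 x0) \<le> \<bar>\<mu>\<bar> * \<bar>\<epsilon> * (k * exp (k * x0)) + (2 * 0 * (x0 - a) + 0)\<bar>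
      + 1/2 * \<sigma>\<^sup>2 * \<bar>\<epsilon> * (2 * k\<^sup>2 * exp (k * x0)) + 2 * 0\<bar>"
    proof (rule local_bound[of "{x0 - d<..<x0 + d}" _ "a < x0"])
      show "{x0 - d<..<x0 + d} \<subseteq> {0<..}" using near by blast
      show "\<bar>x - x0\<bar> < \<delta> \<and> x \<noteq> a \<and> (a < x \<longleftrightarrow> a < x0)" if "x \<in> {x0 - d<..<x0 + d}" for x
        using near[OF that] by blast
      show "W y - (0 * (y - a)\<^sup>2 + 0 * (y - a)) \<le> W x0 - (0 * (x0 - a)\<^sup>2 + 0 * (x0 - a))"
        if "y \<in> {x0 - d<..<x0 + d}" for y
      proof -
        have "0 \<le> y" using near[OF that] by linarith
        from x0(2)[OF this] show ?thesis by simp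
      qed
    qed (use d v12(2) in \<open>simp_all add: \<sigma>_def \<mu>_def\<close>)
    \<comment> \<open>The factor 2 of \<open>superjet_exp\<close> cancels the 1/2 of the diffusion.
      The right side is then at most \<open>q / 2\<close> times the penalty, although
      \<open>v1 - v2\<close> exceeds the penalty.\<close>
    also have "\<dots> = \<epsilon> * exp (k * x0) * (\<bar>\<mu>\<bar> * k + \<sigma>\<^sup>2 * k\<^sup>2)"
      using \<epsilon>(1) k(1) by (simp add: algebra_simps)
    also have "\<dots> \<le> \<epsilon> * exp (k * x0) * (q / 2)"
      using \<epsilon>(1) by (intro mult_left_mono generator) (auto simp: \<sigma>_def \<mu>_def B_def)
    also have "\<dots> < q * (\<epsilon> * exp (k * x0))" using \<epsilon>(1) pos by simp
    also have "\<dots> < q * (v1 x0 - v2 x0)" using v12(1) pos by simp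
    finally show False .
  next
    case True
    \<comment> \<open>The maximum at \<open>a\<close> rules out the first alternative in the choice
      of \<open>\<epsilon>\<close>.\<close>
    have "\<not> W a < W y" if "0 \<le> y" for y using x0(2)[OF that] True by simp
    then have "(\<lambda>x. v1 x - v2 x) differentiable (at a)" using \<epsilon>(3) by (auto simp: W_def)
    then obtain D where D0: "((\<lambda>x. v1 x - v2 x) has_real_derivative D) (at a)"
      by (auto simp: real_differentiable_def)
    have "((\<lambda>x. \<epsilon> * exp (k * x)) has_real_derivative \<epsilon> * (exp (k * a) * k)) (at a)"
      by (auto intro!: derivative_eq_intros)
    from DERIV_diff[OF D0 this] have D: "(W has_real_derivative D - \<epsilon> * (exp (k * a) * k)) (at a)"
      unfolding W_def .
    have "D - \<epsilon> * (exp (k * a) * k) = 0"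
      by (rule DERIV_local_max[OF D pos(1)]) (use x0(2) True in \<open>auto simp: abs_less_iff\<close>)
    then have deriv: "(W has_real_derivative 0) (at a)" using D by simp
    define d where "d = min (min \<delta> a) 1 / 2"
    have d: "0 < d" "d < \<delta>" "d < a" "d \<le> 1" using \<delta>(1) pos by (auto simp: d_def)
    define m where "m = W a"
    have m: "0 < m" using Wx0 True by (simp add: m_def)
    \<comment> \<open>\<open>N\<close> is the cost of the barrier per unit of \<open>K\<close>:
      \<open>q\<close> for lowering \<open>W\<close> by at most \<open>K\<close>,
      \<open>3 * \<bar>\<mu>m\<bar>\<close> for its slope (using \<open>d \<le> 1\<close>),
      \<open>\<sigma>m\<^sup>2\<close> for its curvature \<open>2 * K\<close>. \<open>K\<close>
      spends exactly \<open>q * m\<close>; the strict contradiction comes from the penalty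
      \<open>E\<close>, which costs only half of \<open>q * E\<close>. Moreover \<open>q < N\<close>
      gives \<open>K < m\<close>, so \<open>v1\<close> is positive at \<open>x1\<close>.\<close>
    define N where "N = q + 3 * \<bar>\<mu>m\<bar> + \<sigma>m\<^sup>2"
    have N: "q < N" using pos by (simp add: N_def add_nonneg_pos)
    define K where "K = q * m / N"
    have K: "0 < K" "K * N = q * m" using pos m N by (auto simp: K_def)
    have "K * q < K * N" using N K(1) by (rule mult_strict_left_mono)
    then have "q * K < q * m" using K by (simp add: mult.commute)
    then have Km: "K < m" using pos by simp
    define b where "b = K * d / 2"
    have b: "0 < b" "b \<le> K / 2" using K d by (auto simp: b_def mult_left_le)
    obtain x1 where x1: "x1 \<in> {a - d<..<a}" "W a \<le> W x1 - (K * (x1 - a)\<^sup>2 + b * (x1 - a))"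
      "\<And>y. y \<in> {a - d..a} \<Longrightarrow> W y - (K * (y - a)\<^sup>2 + b * (y - a)) \<le> W x1 - (K * (x1 - a)\<^sup>2 + b * (x1 - a))"
    proof (rule hopf_barrier[OF deriv _ _ d(1) K(1)])
      show "W y \<le> W a" if "y \<in> {a - d..a}" for y using x0(2)[of y] True that d by auto
      show "continuous_on {a - d..a} W" by (rule continuous_on_subset[OF contW]) (use d in auto)
    qed (auto simp: b_def)
    define E where "E = \<epsilon> * exp (k * x1)"
    have E: "0 < E" using \<epsilon>(1) by (simp add: E_def)
    define t where "t = a - x1"
    have t: "0 < t" "t < d" using x1(1) by (auto simp: t_def)
    have bt: "b * t \<le> K"
    proof -
      have "b * t \<le> (K / 2) * 1" using b t d K by (intro mult_mono) auto
      then show ?thesis using K by simp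
    qed
    have "0 \<le> K * (x1 - a)\<^sup>2" using K by simp
    moreover have "b * (x1 - a) = - (b * t)" by (simp add: t_def algebra_simps)
    ultimately have "m - K \<le> W x1" using x1(2) bt by (simp add: m_def)
    then have v12: "m - K + E \<le> v1 x1 - v2 x1" by (simp add: W_def E_def)
    have "0 \<le> v2 x1" using nn2[of x1] x1(1) d by simp
    then have "0 < v1 x1" using v12 Km E by linarith
    have "q * (v1 x1 - v2 x1) \<le> \<bar>\<mu>m\<bar> * \<bar>\<epsilon> * (k * exp (k * x1)) + (2 * K * (x1 - a) + b)\<bar>
      + 1/2 * \<sigma>m\<^sup>2 * \<bar>\<epsilon> * (2 * k\<^sup>2 * exp (k * x1)) + 2 * K\<bar>"
    proof (rule local_bound[of "{a - d<..<a}" _ False])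
      show "{a - d<..<a} \<subseteq> {0<..}" using d by auto
      show "\<bar>x - x0\<bar> < \<delta> \<and> x \<noteq> a \<and> (a < x \<longleftrightarrow> False)" if "x \<in> {a - d<..<a}" for x
        using that d True by auto
      show "W y - (K * (y - a)\<^sup>2 + b * (y - a)) \<le> W x1 - (K * (x1 - a)\<^sup>2 + b * (x1 - a))"
        if "y \<in> {a - d<..<a}" for y
        using that by (intro x1(3)) auto
    qed (use x1(1) \<open>0 < v1 x1\<close> in simp_all)
    also have "\<epsilon> * (k * exp (k * x1)) = k * E" by (simp add: E_def)
    also have "\<epsilon> * (2 * k\<^sup>2 * exp (k * x1)) = 2 * k\<^sup>2 * E" by (simp add: E_def)
    also have "1/2 * \<sigma>m\<^sup>2 * \<bar>2 * k\<^sup>2 * E + 2 * K\<bar> = \<sigma>m\<^sup>2 * k\<^sup>2 * E + \<sigma>m\<^sup>2 * K"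
      using E K by (simp add: abs_of_nonneg algebra_simps)
    also have "\<bar>\<mu>m\<bar> * \<bar>k * E + (2 * K * (x1 - a) + b)\<bar> + (\<sigma>m\<^sup>2 * k\<^sup>2 * E + \<sigma>m\<^sup>2 * K)
      \<le> \<bar>\<mu>m\<bar> * (k * E + 3 * K) + (\<sigma>m\<^sup>2 * k\<^sup>2 * E + \<sigma>m\<^sup>2 * K)"
    \<comment> \<open>The barrier's slope is at most \<open>2 * K * t + b\<close> in absolute value,
      with \<open>t \<le> 1\<close> and \<open>b \<le> K / 2\<close>; this is where the 3 in
      \<open>N\<close> comes from.\<close>
    proof (intro add_right_mono mult_left_mono)
      have "2 * K * (x1 - a) = - (2 * (K * t))" by (simp add: t_def algebra_simps)
      moreover have "K * t \<le> K * 1" using K t d by (intro mult_left_mono) auto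
      moreover have "0 < K * t" "0 < k * E" using K t k E by simp_all
      ultimately show "\<bar>k * E + (2 * K * (x1 - a) + b)\<bar> \<le> k * E + 3 * K" using b by linarith
    qed simp
    also have "\<bar>\<mu>m\<bar> * (k * E + 3 * K) + (\<sigma>m\<^sup>2 * k\<^sup>2 * E + \<sigma>m\<^sup>2 * K)
      = E * (\<bar>\<mu>m\<bar> * k + \<sigma>m\<^sup>2 * k\<^sup>2) + (K * N - q * K)"
      by (simp add: N_def algebra_simps)
    also have "\<dots> \<le> E * (q / 2) + (q * m - q * K)"
      using E generator[of \<mu>m \<sigma>m] K by (simp add: B_def mult_left_mono)
    also have "\<dots> < q * (m - K + E)" using E pos by (simp add: algebra_simps)
    also have "\<dots> \<le> q * (v1 x1 - v2 x1)" using v12 pos by simp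
    finally show False by simp
  qed
qed

end
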